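(* Let $q$ be a power of a prime $p$, let $A(X)\in \mathbb{F}_q[X]$ be an additive polynomial not of the form $aX^{p^h}$ (with $a\in\mathbb{F}_q$, $h\ge 0$) and, for each $b\in \mathbb{F}_q^*$, set $A_b(X)=A(X)+b$. Then the following hold: (i) For every $n\ge 1$, we have $s_A(np)\in \{s_A(n),\, p\cdot s_A(n)\}$ and, in particular, for every $n\ge 1$ there exists an integer $i$ with $0\le i< \log_p n+1$ such that $s_A(n)=s_A(1)\cdot p^i$. (ii) For every $b\in \mathbb{F}_q^*$ and every $n\ge 1$, we have $s_{A_b}(n)\in \{s_A(n),\, p\cdot s_{A}(n)\}$. (iii) The sequence $\left\{\frac{s_{A}(n)}{n}\right\}_{n\ge 1}$ is bounded and its set of limit points equals $[c_A, pc_A]$ for some real number $c_A>0$. (iv) If $c_A$ is as in (iii), then for every $b\in\mathbb{F}_q^*$ the sequence $\left\{\frac{s_{A_b}(n)}{n}\right\}_{n\ge 1}$ is bounded and its set of limit points is contained in the interval $[c_A, p^2c_A]$. (v) $c_{A^{(k)}}=k\cdot c_A$ for every integer $k\ge 1$, where $c_{A^{(k)}}$ is the constant of (iii) associated with the additive polynomial $A^{(k)}$. Moreover, for $s_0=\max \{j>0\,:\, s_A(j)=s_A(1)\}$, there exist a polynomial $A_*\in \mathbb{F}_q[X]$ of the form $R^q$ with $R\in \mathbb{F}_q[X]$ additive and an integer $r\ge 1$ such that $$(X^{q^{s_A(1)}}-X)^{q^r}=X^{q^{s_A(1)+r}}-X^{q^r}=A_*(A^{(s_0)}(X)).$$ In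 particular, $c_A\le \frac{s_A(1)}{s_0}$, with equality if and only if the $\mathbb{F}_p$-linear map $z\mapsto A_*(z)$ is not nilpotent over $\mathbb{F}_{q^{s_A(1)}}$. In the case of equality, we also have $$s_A(n)=s_A(1)\,p^{\left\lceil \log_p \frac{n}{s_0}\right\rceil}\quad\text{for all integers } n>s_0.$$
   Context: $\mathbb{F}_q$ denotes the finite field with $q$ elements. A polynomial $f\in\mathbb{F}_q[X]$ is additive if $f(X+Y)=f(X)+f(Y)$ in $\mathbb{F}_q[X,Y]$; equivalently, with $p$ the characteristic, $f=\sum_{i=0}^h a_iX^{p^i}$ with $a_i\in\mathbb{F}_q$. For a polynomial $F$ and $n\ge 1$, $F^{(n)}(X)$ denotes the $n$-fold composition of $F$ with itself. For a nonconstant $F\in\mathbb{F}_q[X]$ and $n\ge1$, $s_F(n)$ is the degree over $\mathbb{F}_q$ of the splitting field of $F^{(n)}(X)$, i.e. the smallest positive integer $s$ such that $F^{(n)}(X)$ splits completely over $\mathbb{F}_{q^{s}}$. $R^q$ denotes the ordinary $q$-th power of the polynomial $R$. The map $z\mapsto A_*(z)$ over $\mathbb{F}_{q^{s_A(1)}}$ is the $\mathbb{F}_p$-linear map from $\mathbb{F}_{q^{s_A(1)}}$ to itself given by evaluating $A_*$; nilpotent means that some iterate of it is the zero map. *)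

theory Defs
  imports "HOL-Analysis.Analysis" "HOL-Algebra.Algebraic_Closure_Type"
begin

text \<open>
  The ground field is a type \<open>'a::finite_field\<close>, so \<open>q\<close> is \<open>CARD('a)\<close>. All extension fields are
  taken inside the library's algebraic closure \<open>'a alg_closure\<close>, with embedding \<open>to_ac\<close>.
\<close>

section \<open>The extension of degree \<open>s\<close>\<close>

text \<open>
  This is the unique subfield with \<open>q ^ s\<close> elements; see \<open>ext_field_unique\<close> below. For \<open>s \<ge> 1\<close> it
  contains \<open>range to_ac\<close>.
\<close>

definition ext_field :: "nat \<Rightarrow> 'a::finite_field alg_closure set" where
  "ext_field s = (THE K. subfield K ring_of_type_algebra \<and> card K = CARD('a) ^ s)"

lemma of_nat_card_eq_0: "(of_nat (CARD('a)) :: 'a::finite_field) = 0"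
proof -
  have "(\<Sum>y\<in>(UNIV::'a set). y) = (\<Sum>y\<in>UNIV. 1 + y)"
    by (rule sum.reindex_bij_witness[of _ "\<lambda>y. 1 + y" "\<lambda>y. y - 1"]) auto
  thus ?thesis by (simp add: sum.distrib)
qed

lemma card_frobenius_fixed:
  fixes s :: nat
  assumes s: "s > 0"
  shows "card {x :: 'a::finite_field alg_closure. x ^ (CARD('a) ^ s) = x} = CARD('a) ^ s"
proof -
  define N where "N = CARD('a) ^ s"
  have two: "CARD('a) \<ge> 2"
  proof -
    have "card {0, 1 :: 'a} \<le> CARD('a)" by (rule card_mono) auto
    thus ?thesis by simp
  qed
  have N2: "N \<ge> 2"
    using two s self_le_power[of "CARD('a)" s] unfolding N_def by linarith
  have "(of_nat (CARD('a)) :: 'a alg_closure) = 0"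
    by (metis of_nat_card_eq_0 to_ac_0 to_ac_of_nat)
  hence N0: "(of_nat N :: 'a alg_closure) = 0"
    using s by (simp add: N_def)
  define P :: "'a alg_closure poly" where "P = Polynomial.monom 1 N - Polynomial.monom 1 1"
  have degP: "Polynomial.degree P = N"
  proof -
    have "Polynomial.coeff P N = 1" using N2 by (simp add: P_def)
    moreover have "Polynomial.degree P \<le> N"
      unfolding P_def using N2
      by (intro degree_diff_le) (auto simp: Polynomial.degree_monom_eq)
    ultimately show ?thesis using le_degree[of P N] by simp
  qed
  have P0: "P \<noteq> 0" using degP N2 by auto
  have dP: "pderiv P = - 1"
    by (simp add: P_def pderiv_diff pderiv_monom N0 monom_0 one_pCons)
  have ord1: "Polynomial.order x P = 1" if "poly P x = 0" for x
  proof (rule ccontr)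
    assume "Polynomial.order x P \<noteq> 1"
    moreover have "Polynomial.order x P > 0" using that P0 by (simp add: order_root)
    ultimately have "2 \<le> Polynomial.order x P" by simp
    hence "[:-x, 1:] ^ 2 dvd P" using P0 by (simp add: order_divides)
    then obtain Q where Q: "P = [:-x, 1:] ^ 2 * Q" by (elim dvdE)
    define L where "L = [:-x, 1:]"
    have "P = L * (L * Q)" and L: "poly L x = 0"
      unfolding L_def Q by (simp_all only: power2_eq_square mult.assoc) simp
    hence "poly (pderiv P) x = 0"
      by (simp add: pderiv_mult)
    thus False by (simp add: dP)
  qed
  obtain A where A: "size A = Polynomial.degree P"
      "P = Polynomial.smult (Polynomial.lead_coeff P) (\<Prod>x\<in>#A. [:-x, 1:])"
    using alg_closed_imp_factorization[OF P0] by blast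
  have lc: "Polynomial.lead_coeff P \<noteq> 0" using P0 by simp
  have root: "poly P x = 0 \<longleftrightarrow> x \<in># A" for x
    by (subst A(2)) (use lc in \<open>auto simp: poly_prod_mset prod_mset_zero_iff\<close>)
  have cnt: "count A x \<le> 1" for x
  proof (rule ccontr)
    assume "\<not> count A x \<le> 1"
    hence c2: "2 \<le> count A x" by simp
    then have "replicate_mset 2 x \<subseteq># A"
      by (simp add: count_le_replicate_mset_subset_eq)
    then obtain B where "A = replicate_mset 2 x + B"
      by (auto simp: mset_subset_eq_exists_conv)
    hence "(\<Prod>x\<in>#A. [:-x, 1:]) = [:-x,1:] ^ 2 * (\<Prod>x\<in>#B. [:-x, 1:])"
      by (simp only: numeral_2_eq_2 replicate_mset_Suc replicate_mset_0) (simp only: image_mset_union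
          image_mset_add_mset prod_mset_Un prod_mset.add_mset image_mset_empty prod_mset_empty
          power_Suc power_0 mult_1_right)
    hence "[:-x,1:] ^ 2 dvd P"
      by (subst A(2)) (metis dvd_smult dvd_triv_left)
    hence "2 \<le> Polynomial.order x P" using P0 by (simp add: order_divides)
    moreover have "poly P x = 0" using root c2 by (metis count_greater_zero_iff less_le_trans pos2)
    ultimately show False using ord1 by fastforce
  qed
  have "A = mset_set (set_mset A)"
  proof (rule multiset_eqI)
    fix x
    show "count A x = count (mset_set (set_mset A)) x"
    proof (cases "x \<in># A")
      case True
      hence "count A x > 0" by simp
      with cnt[of x] have "count A x = 1" by linarith
      with True show ?thesis by (simp add: count_mset_set)
    qed (simp add: not_in_iff)
  qed
  hence "size A = card (set_mset A)"
    by (metis size_mset_set)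
  moreover have "set_mset A = {x. x ^ N = x}"
    using root by (auto simp: P_def poly_monom)
  ultimately show ?thesis using A(1) degP by (simp add: N_def)
qed

lemma subfield_type_algebraD:
  fixes K :: "'a::field set"
  assumes "subfield K ring_of_type_algebra"
  shows "0 \<in> K" "1 \<in> K" "x \<in> K \<Longrightarrow> y \<in> K \<Longrightarrow> x * y \<in> K"
    "x \<in> K \<Longrightarrow> inverse x \<in> K"
proof -
  let ?R = "ring_of_type_algebra :: 'a ring"
  interpret R: field ?R by rule
  have mult [simp]: "x \<otimes>\<^bsub>?R\<^esub> y = x * y" for x y by (simp add: ring_of_type_algebra_def)
  have zero [simp]: "\<zero>\<^bsub>?R\<^esub> = 0" by (simp add: ring_of_type_algebra_def)
  have one [simp]: "\<one>\<^bsub>?R\<^esub> = 1" by (simp add: ring_of_type_algebra_def)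
  have carr [simp]: "carrier ?R = UNIV" by (simp add: ring_of_type_algebra_def)
  have sr: "subring K ?R" using subfieldE(1)[OF assms] .
  show z: "0 \<in> K" using subringE(2)[OF sr] by simp
  show "1 \<in> K" using subringE(3)[OF sr] by simp
  show "x \<in> K \<Longrightarrow> y \<in> K \<Longrightarrow> x * y \<in> K" using subringE(6)[OF sr, of x y] by simp
  show "inverse x \<in> K" if "x \<in> K"
  proof (cases "x = 0")
    case False
    have "inv\<^bsub>?R\<^esub> x = inverse x" using False by (intro R.comm_inv_char) auto
    moreover have "inv\<^bsub>?R\<^esub> x \<in> K" using R.subfield_m_inv(1)[OF assms, of x] that False by simp
    ultimately show ?thesis by simp
  qed (use z in simp)
qed

lemma subfield_frobenius_fixed:
  fixes s :: nat
  assumes p: "Factorial_Ring.prime p" and q: "CARD('a) = p ^ m"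
  shows "subfield {x :: 'a::finite_field alg_closure. x ^ (CARD('a) ^ s) = x} ring_of_type_algebra"
proof -
  let ?R = "ring_of_type_algebra :: 'a alg_closure ring"
  let ?K = "{x :: 'a alg_closure. x ^ (CARD('a) ^ s) = x}"
  interpret R: field ?R by rule
  have mult [simp]: "x \<otimes>\<^bsub>?R\<^esub> y = x * y" for x y by (simp add: ring_of_type_algebra_def)
  have add [simp]: "x \<oplus>\<^bsub>?R\<^esub> y = x + y" for x y by (simp add: ring_of_type_algebra_def)
  have zero [simp]: "\<zero>\<^bsub>?R\<^esub> = 0" by (simp add: ring_of_type_algebra_def)
  have one [simp]: "\<one>\<^bsub>?R\<^esub> = 1" by (simp add: ring_of_type_algebra_def)
  have carr [simp]: "carrier ?R = UNIV" by (simp add: ring_of_type_algebra_def)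
  have uminus [simp]: "\<ominus>\<^bsub>?R\<^esub> x = - x" for x
    by (intro R.minus_equality) auto
  have inv: "inv\<^bsub>?R\<^esub> x = inverse x" if "x \<noteq> 0" for x
    using that by (intro R.comm_inv_char) auto
  have "(of_nat (p ^ m) :: 'a) = 0"
    using of_nat_card_eq_0 q by metis
  hence "(of_nat p :: 'a) = 0" by (simp add: of_nat_power)
  hence "CHAR('a) dvd p" by (simp add: of_nat_eq_0_iff_char_dvd)
  moreover have "CHAR('a) \<noteq> 1" by simp
  ultimately have char: "CHAR('a) = p" using p by (auto simp: prime_nat_iff)
  have frob: "(x + y :: 'a alg_closure) ^ (CARD('a) ^ s) = x ^ (CARD('a) ^ s) + y ^ (CARD('a) ^ s)" for x y
    by (rule freshmans_dream'[where n = "m * s"]) (use char p q in \<open>simp_all add: power_mult\<close>)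
  have pos: "CARD('a) ^ s > 0" by simp
  have frob_minus: "(- x :: 'a alg_closure) ^ (CARD('a) ^ s) = - (x ^ (CARD('a) ^ s))" for x
    using frob[of x "-x"] pos by (simp add: zero_power add_eq_0_iff)
  show ?thesis
  proof (rule R.subfieldI')
    show "subring ?K ?R"
      by (rule R.subringI) (use pos in \<open>auto simp: frob frob_minus power_mult_distrib\<close>)
    show "inv\<^bsub>?R\<^esub> k \<in> ?K" if "k \<in> ?K - {\<zero>\<^bsub>?R\<^esub>}" for k
      using that by (simp add: inv power_inverse)
  qed
qed

theorem ext_field_unique:
  assumes p: "Factorial_Ring.prime p" and q: "CARD('a::finite_field) = p ^ m" and s: "s > 0"
  shows "subfield K ring_of_type_algebra \<and> card K = CARD('a) ^ s \<longleftrightarrow>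
           K = {x :: 'a alg_closure. x ^ (CARD('a) ^ s) = x}"
proof
  assume "K = {x :: 'a alg_closure. x ^ (CARD('a) ^ s) = x}"
  thus "subfield K ring_of_type_algebra \<and> card K = CARD('a) ^ s"
    using subfield_frobenius_fixed[OF p q] card_frobenius_fixed[OF s] by simp
next
  assume *: "subfield K ring_of_type_algebra \<and> card K = CARD('a) ^ s"
  note K = subfield_type_algebraD[OF conjunct1[OF *]]
  have cardF: "card {x :: 'a alg_closure. x ^ (CARD('a) ^ s) = x} = CARD('a) ^ s"
    by (rule card_frobenius_fixed[OF s])
  have fin: "finite K" using * by (intro card_ge_0_finite) simp
  have finF: "finite {x :: 'a alg_closure. x ^ (CARD('a) ^ s) = x}"
    by (intro card_ge_0_finite) (subst cardF, simp)
  have "x ^ card K = x" if "x \<in> K" for x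
  proof (cases "x = 0")
    case False
    have "(\<Prod>y\<in>K-{0}. x * y) = (\<Prod>y\<in>K-{0}. y)"
      by (rule prod.reindex_bij_witness[of _ "\<lambda>y. inverse x * y" "\<lambda>y. x * y"])
         (use False that K in auto)
    hence "x ^ card (K - {0}) * \<Prod>(K-{0}) = \<Prod>(K-{0})"
      by (simp add: prod.distrib)
    moreover have "\<Prod>(K-{0}) \<noteq> 0" using fin by simp
    ultimately have "x ^ card (K - {0}) = 1" by simp
    moreover have "card K = Suc (card (K - {0}))"
      using card.remove[OF fin K(1)] by simp
    ultimately show ?thesis by simp
  next
    case True
    thus ?thesis using * by (simp add: zero_power)
  qed
  hence sub: "K \<subseteq> {x. x ^ (CARD('a) ^ s) = x}" using * by auto
  show "K = {x. x ^ (CARD('a) ^ s) = x}"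
    by (rule card_subset_eq[OF finF sub]) (simp only: cardF *)
qed

corollary ext_field_eq:
  assumes "Factorial_Ring.prime p" "CARD('a::finite_field) = p ^ m" "s > 0"
  shows "ext_field s = {x :: 'a alg_closure. x ^ (CARD('a) ^ s) = x}"
  unfolding ext_field_def ext_field_unique[OF assms] by simp


section \<open>Iterates and splitting degrees\<close>

text \<open>
  The identity \<open>f(U+V) = f(U)+f(V)\<close> is stated in \<open>('a[U])[V]\<close>, by evaluating \<open>f\<close> there.
  (\<open>X\<close> is a reserved token of HOL-Algebra.)
\<close>

definition additive_poly :: "'a::field poly \<Rightarrow> bool" where
  "additive_poly f \<longleftrightarrow>
     (let F = map_poly (\<lambda>c. [:[:c:]:]) f :: 'a poly poly poly;
          U = [:[:0, 1:]:]; V = [:0, 1:]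
      in poly F (U + V) = poly F U + poly F V)"

definition iter_poly :: "nat \<Rightarrow> 'a::comm_semiring_1 poly \<Rightarrow> 'a poly" where
  "iter_poly n F = (pcompose F ^^ n) [:0, 1:]"

definition splits_over :: "'b::field set \<Rightarrow> 'b poly \<Rightarrow> bool" where
  "splits_over K f \<longleftrightarrow>
     (\<exists>c\<in>K. \<exists>A. set_mset A \<subseteq> K \<and> f = Polynomial.smult c (\<Prod>x\<in>#A. [:-x, 1:]))"

definition split_deg :: "'a::finite_field poly \<Rightarrow> nat \<Rightarrow> nat" where
  "split_deg F n = (LEAST s. s > 0 \<and> splits_over (ext_field s) (map_poly to_ac (iter_poly n F)))"

text \<open>The value at \<open>n = 0\<close> is irrelevant: only indices \<open>n \<ge> 1\<close> are used below.\<close>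

definition split_ratio :: "'a::finite_field poly \<Rightarrow> nat \<Rightarrow> real" where
  "split_ratio F n = real (split_deg F n) / real n"


section \<open>Limit points and the constant \<open>c_A\<close>\<close>

text \<open>Limit points of the sequence \<open>(u n)\<close> indexed by \<open>n \<ge> 1\<close>, i.e. its subsequential limits.\<close>

definition limit_points :: "(nat \<Rightarrow> real) \<Rightarrow> real set" where
  "limit_points u = {l. \<exists>r. strict_mono r \<and> (\<forall>k. r k \<ge> 1) \<and> (\<lambda>k. u (r k)) \<longlonglongrightarrow> l}"

definition split_const :: "'a::finite_field poly \<Rightarrow> real" where
  "split_const A =
     (THE c. c > 0 \<and> limit_points (split_ratio A) = {c..real CHAR('a) * c})"

lemma split_const_eq:
  fixes A :: "'a::finite_field poly"
  assumes "c > 0" "limit_points (split_ratio A) = {c..real CHAR('a) * c}"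
  shows "split_const A = c"
  unfolding split_const_def
proof (rule the_equality)
  have ge: "d \<le> real CHAR('a) * d" if "d > 0" for d :: real
  proof -
    have "CHAR('a) > 0" by (rule CHAR_pos)
    hence "1 \<le> real CHAR('a)" by linarith
    from mult_right_mono[OF this, of d] that show ?thesis by simp
  qed
  fix d assume d: "d > 0 \<and> limit_points (split_ratio A) = {d..real CHAR('a) * d}"
  have "{d..real CHAR('a) * d} = {c..real CHAR('a) * c}"
    by (rule trans[OF sym[OF conjunct2[OF d]] assms(2)])
  from iffD1[OF Icc_eq_Icc this] ge[OF conjunct1[OF d]] show "d = c" by blast
qed (rule conjI[OF assms])


section \<open>Nilpotent maps\<close>

definition nilpotent_on :: "'b::zero set \<Rightarrow> ('b \<Rightarrow> 'b) \<Rightarrow> bool" where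
  "nilpotent_on V f \<longleftrightarrow> (\<exists>k. \<forall>z\<in>V. (f ^^ k) z = 0)"

end

(*
  Let \<sigma> be the q-power Frobenius on the algebraic closure and a the map x \<mapsto> A(x).
  Both are additive, they commute, and a is surjective with finite nonzero kernel. The number
  s_A(n) is the order of \<sigma> on V_n = ker (a^n). The operator \<sigma>^s - 1 with s = s_A(n) maps
  V_(k n) into V_((k-1) n), and its p-th power is \<sigma>^(s p) - 1 in characteristic p, so
  s_A(n p) divides p s_A(n); this gives (i), and (ii) in the same way. Since V_n has at least 2^n
  elements, all lying in the field with q^s_A(n) elements, s_A grows at least linearly. If n_i
  denotes the largest n with s_A(n) \<le> s_A(1) p^i, then n_i / p^i is nondecreasing and bounded,
  with limit L say, and (iii) to (v) hold with c_A = s_A(1) / L. Equality c_A = s_A(1) / s_0 means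
  that n_i = p^i s_0 for all i. With N = \<sigma>^s_A(1) - 1, a map B satisfying
  B a^s_0 = \<sigma>^r N commutes with a, so that B^k (a^s_0)^k = \<sigma>^(r k) N^k for k = p^i, and
  n_i = p^i s_0 says that B^k does not vanish on V_1. The polynomial A_* itself comes from right
  division by A^(s_0) in the ring of additive polynomials under composition.
*)

theory Submission
  imports Defs "HOL-Algebra.Exponent"
begin

section \<open>Sequences growing by powers of a prime\<close>

text \<open>The properties of n -> s_A(n) behind (iii) to (v), kept free of fields so that they also
  apply to n -> s_A(k n). The constant \<open>C\<close> expresses at least linear growth.\<close>

locale growth_sequence =
  fixes s :: "nat \<Rightarrow> nat" and p C :: nat
  assumes p_ge_2: "p \<ge> 2" and s_1_pos: "s 1 > 0"
    and s_mono: "1 \<le> m \<Longrightarrow> m \<le> n \<Longrightarrow> s m \<le> s n"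
    and s_power: "1 \<le> n \<Longrightarrow> \<exists>i. s n = s 1 * p ^ i"
    and s_mult: "1 \<le> n \<Longrightarrow> s (n * p) \<le> p * s n"
    and s_linear: "1 \<le> n \<Longrightarrow> n \<le> C * s n"
begin

section \<open>Levels of the sequence and the indices n_i\<close>

definition last_index :: "nat \<Rightarrow> nat" where
  "last_index i = Max {n. 1 \<le> n \<and> s n \<le> s 1 * p ^ i}"

lemma finite_level: "finite {n. 1 \<le> n \<and> s n \<le> s 1 * p ^ i}"
proof (rule finite_subset)
  show "{n. 1 \<le> n \<and> s n \<le> s 1 * p ^ i} \<subseteq> {..C * (s 1 * p ^ i)}"
    using s_linear by (auto intro: order_trans mult_le_mono2)
qed simp

lemma one_in_level: "1 \<in> {n. 1 \<le> n \<and> s n \<le> s 1 * p ^ i}"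
  using p_ge_2 by simp

lemma last_index_in: "1 \<le> last_index i" "s (last_index i) \<le> s 1 * p ^ i"
  using Max_in[OF finite_level[of i]] one_in_level[of i] unfolding last_index_def by blast+

text \<open>By monotonicity every level is an initial segment of the positive integers, so it is
  determined by its maximum.\<close>

lemma le_last_index_iff: "n \<le> last_index i \<longleftrightarrow> s n \<le> s 1 * p ^ i" if "1 \<le> n"
proof
  assume "n \<le> last_index i"
  thus "s n \<le> s 1 * p ^ i" using s_mono[OF that] last_index_in(2) order_trans by blast
next
  assume "s n \<le> s 1 * p ^ i"
  thus "n \<le> last_index i" unfolding last_index_def using that finite_level by (intro Max_ge) auto
qed

text \<open>Multiplying an index by p costs at most a factor p in \<open>s\<close>, so n_i p still
  belongs to level i + 1.\<close>

lemma last_index_mult: "last_index i * p \<le> last_index (Suc i)"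
proof -
  have "s (last_index i * p) \<le> p * s (last_index i)" using s_mult last_index_in(1) by blast
  also have "\<dots> \<le> p * (s 1 * p ^ i)" using last_index_in(2) by simp
  finally show ?thesis
    using last_index_in(1)[of i] p_ge_2 by (subst le_last_index_iff) (simp_all add: mult_ac)
qed

lemma last_index_less: "last_index i < last_index (Suc i)"
proof -
  have "last_index i * 1 < last_index i * p" using last_index_in(1)[of i] p_ge_2
    by (intro mult_strict_left_mono) simp_all
  thus ?thesis using last_index_mult[of i] by linarith
qed

lemma strict_mono_last_index: "strict_mono last_index"
  using last_index_less by (rule strict_monoI_Suc)

lemma s_le_last_index_0: "s n = s 1" if "1 \<le> n" "n \<le> last_index 0"
  using le_last_index_iff[OF that(1), of 0] that s_mono[of 1 n] by simp

text \<open>The only values of \<open>s\<close> are \<open>s 1 * p ^ j\<close>, and none of them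
  lies strictly between two consecutive thresholds.\<close>

lemma s_between: "s n = s 1 * p ^ Suc i" if "last_index i < n" "n \<le> last_index (Suc i)"
proof -
  have n: "1 \<le> n" using that by simp
  obtain j where j: "s n = s 1 * p ^ j" using s_power[OF n] by blast
  have "\<not> s n \<le> s 1 * p ^ i" "s n \<le> s 1 * p ^ Suc i"
    using le_last_index_iff[OF n] that by (metis not_le)+
  hence "\<not> j \<le> i" "j \<le> Suc i"
    using j s_1_pos p_ge_2 by (simp_all add: power_increasing_iff del: power_Suc)
  hence "j = Suc i" by simp
  thus ?thesis using j by simp
qed

lemma between_ex: "\<exists>i. last_index i < n \<and> n \<le> last_index (Suc i)" if "last_index 0 < n"
proof -
  define j where "j = (LEAST j. n \<le> last_index j)"
  \<comment> \<open>A strictly increasing sequence of naturals dominates the identity, so some level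
    contains n; the least such level is the one wanted.\<close>
  have "n \<le> last_index n" by (rule strict_mono_imp_increasing[OF strict_mono_last_index])
  hence j: "n \<le> last_index j" unfolding j_def by (rule LeastI)
  have "j \<noteq> 0"
  proof
    assume "j = 0"
    with j that show False by simp
  qed
  then obtain i where i: "j = Suc i" using not0_implies_Suc by blast
  have "\<not> n \<le> last_index i" unfolding not_less[symmetric]
    using not_less_Least[of i "\<lambda>j. n \<le> last_index j"] i unfolding j_def by auto
  thus ?thesis using i j by (intro exI[of _ i]) simp
qed

section \<open>The limit L of n_i / p^i and the constant c_A = s_A(1) / L\<close>

definition density :: "nat \<Rightarrow> real" where
  "density i = real (last_index i) / real p ^ i"

lemma p_pos: "real p > 0" using p_ge_2 by simp

lemma density_pos: "density i > 0"
  using last_index_in(1)[of i] p_pos by (simp add: density_def)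

lemma incseq_density: "incseq density"
proof (rule incseq_SucI)
  fix i
  have "real (last_index i) * real p \<le> real (last_index (Suc i))"
    using last_index_mult[of i] by (metis of_nat_mult of_nat_mono)
  thus "density i \<le> density (Suc i)" using p_pos by (simp add: density_def field_simps)
qed

text \<open>Linear growth at the index n_i bounds n_i by a constant multiple of p^i.\<close>

lemma density_le: "density i \<le> real (C * s 1)"
proof -
  have "last_index i \<le> C * s (last_index i)" using s_linear last_index_in(1) by blast
  also have "\<dots> \<le> C * (s 1 * p ^ i)" using last_index_in(2) by simp
  finally have "real (last_index i) \<le> real (C * s 1) * real p ^ i"
    by (metis of_nat_mono of_nat_mult of_nat_power mult.assoc)
  thus ?thesis using p_pos by (simp add: density_def field_simps)
qed

definition limit_density :: real where "limit_density = lim density"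

lemma density_tendsto: "density \<longlonglongrightarrow> limit_density"
  unfolding limit_density_def
  by (rule incseq_convergent[OF incseq_density, of "real (C * s 1)"])
     (use density_le in \<open>auto simp: limI\<close>)

lemma density_le_limit: "density i \<le> limit_density"
  by (rule incseq_le[OF incseq_density density_tendsto])

lemma limit_density_pos: "limit_density > 0"
  using density_pos[of 0] density_le_limit[of 0] by linarith

definition ratio_const :: real where "ratio_const = real (s 1) / limit_density"

lemma ratio_const_pos: "ratio_const > 0"
  using limit_density_pos s_1_pos by (simp add: ratio_const_def)

text \<open>If \<open>s n = s 1 * p ^ i\<close>, then n \<le> n_i, hence n / p^i is at most n_i /
  p^i and so at most L.\<close>

lemma ratio_const_le: "ratio_const \<le> real (s n) / real n" if n: "1 \<le> n"
proof -
  obtain i where i: "s n = s 1 * p ^ i" using s_power[OF n] by blast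
  have "n \<le> last_index i" using le_last_index_iff[OF n] i by simp
  hence "real n / real p ^ i \<le> density i" using p_pos by (simp add: density_def divide_right_mono)
  hence le: "real n / real p ^ i \<le> limit_density" using density_le_limit[of i] by linarith
  have "ratio_const \<le> real (s 1) / (real n / real p ^ i)"
    unfolding ratio_const_def using le n p_pos by (intro divide_left_mono) (auto simp: limit_density_pos)
  thus ?thesis using i by simp
qed

text \<open>If n_j < n \<le> n_(j+1), then j \<ge> i and \<open>s n = s 1 * p ^ Suc j\<close>, while
  n exceeds n_j. The bound is phrased with a fixed i, so that i can tend to infinity
  afterwards.\<close>

lemma ratio_less: "real (s n) / real n < real p * real (s 1) / density i" if n: "last_index i < n"
proof -
  have "last_index 0 \<le> last_index i" using strict_mono_last_index by (simp add: strict_mono_less_eq)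
  then obtain j where j: "last_index j < n" "n \<le> last_index (Suc j)" using between_ex[of n] n by auto
  have "i < Suc j" using n j(2) strict_mono_last_index by (meson less_le_trans strict_mono_less)
  hence "density i \<le> density j" using incseq_density by (simp add: incseq_def)
  have "real (s n) / real n = real (s 1) * real p ^ Suc j / real n"
    using s_between[OF j] by simp
  also have "\<dots> < real (s 1) * real p ^ Suc j / real (last_index j)"
    using j(1) last_index_in(1)[of j] s_1_pos p_pos by (intro divide_strict_left_mono) auto
  also have "\<dots> = real p * real (s 1) / density j"
    using p_pos by (simp add: density_def)
  also have "\<dots> \<le> real p * real (s 1) / density i"
    using \<open>density i \<le> density j\<close> density_pos[of i] density_pos[of j]
    by (intro divide_left_mono) auto
  finally show ?thesis .
qed

section \<open>Boundedness and limit points of the ratios\<close>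

lemma ratio_bounded: "bounded ((\<lambda>n. real (s n) / real n) ` {1..})"
proof -
  have "real (s n) / real n \<le> max (real (s 1)) (real p * real (s 1) / density 0)" if "1 \<le> n" for n
  proof (cases "n \<le> last_index 0")
    case True
    have "real (s n) / real n \<le> real (s 1) / 1"
      unfolding s_le_last_index_0[OF that True] using that by (intro divide_left_mono) auto
    thus ?thesis by simp
  next
    case False
    thus ?thesis using ratio_less[of 0 n] by simp
  qed
  thus ?thesis
    by (intro boundedI[of _ "max (real (s 1)) (real p * real (s 1) / density 0)"]) auto
qed

text \<open>Along a subsequence each upper bound holds from some point on because \<open>r k\<close>
  is at least k; then i tends to infinity. The general \<open>u\<close> and \<open>K\<close> serve
  both (iii), with K = p s(1), and (iv), with K = p^2 s(1).\<close>

lemma limit_point_bounds: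
  assumes "l \<in> limit_points u"
    and lower: "\<And>n. 1 \<le> n \<Longrightarrow> ratio_const \<le> u n"
    and upper: "\<And>i n. last_index i < n \<Longrightarrow> u n \<le> K / density i"
  shows "ratio_const \<le> l" and "l \<le> K / limit_density"
proof -
  obtain r :: "nat \<Rightarrow> nat" where r: "strict_mono r" "\<And>k. r k \<ge> 1" and lim: "(\<lambda>k. u (r k)) \<longlonglongrightarrow> l"
    using assms(1) unfolding limit_points_def by auto
  show "ratio_const \<le> l"
    by (rule LIMSEQ_le_const[OF lim]) (use lower r in auto)
  show "l \<le> K / limit_density"
  proof (rule LIMSEQ_le_const)
    show "(\<lambda>i. K / density i) \<longlonglongrightarrow> K / limit_density"
      using density_tendsto limit_density_pos by (intro tendsto_intros) auto
    have "l \<le> K / density i" for i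
    proof (rule LIMSEQ_le_const2[OF lim], intro exI allI impI)
      fix k assume "Suc (last_index i) \<le> k"
      also have "k \<le> r k" by (rule strict_mono_imp_increasing[OF r(1)])
      finally show "u (r k) \<le> K / density i" using upper by simp
    qed
    thus "\<exists>N. \<forall>i\<ge>N. l \<le> K / density i" by blast
  qed
qed

text \<open>To reach a given l, use that \<open>s\<close> is constant on the block n_i < n \<le>
  n_(i+1): the ratio there is close to l when n is close to x p^(i+1) with x = s(1) / l.\<close>

lemma limit_points_ratio: "limit_points (\<lambda>n. real (s n) / real n) = {ratio_const..real p * ratio_const}"
proof (intro equalityI subsetI)
  fix l assume "l \<in> limit_points (\<lambda>n. real (s n) / real n)"
  note bounds = limit_point_bounds[OF this ratio_const_le less_imp_le[OF ratio_less]]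
  show "l \<in> {ratio_const..real p * ratio_const}"
    using bounds unfolding ratio_const_def times_divide_eq_right by simp
next
  fix l assume l: "l \<in> {ratio_const..real p * ratio_const}"
  hence l0: "l > 0" using ratio_const_pos by simp
  define x where "x = real (s 1) / l"
  have x0: "x > 0" using l0 s_1_pos by (simp add: x_def)
  have "x \<le> limit_density" "limit_density / real p \<le> x"
    using l l0 limit_density_pos p_pos by (simp_all add: x_def ratio_const_def field_simps)
  \<comment> \<open>Divided by p^(i+1), the ends of the block tend to L / p and L. As x lies between
    these limits, truncating at the ends of the block does not change the limit x.\<close>
  hence x_clamp: "min limit_density (max (limit_density / real p) x) = x" by simp
  \<comment> \<open>The index at which \<open>s\<close> equals \<open>s 1 * p ^ Suc i\<close> that is closest to \<open>x * p ^ Suc i\<close>.\<close>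
  define r where "r i = min (last_index (Suc i))
    (max (Suc (last_index i)) (nat \<lceil>x * real p ^ Suc i\<rceil>))" for i
  have r_bounds: "last_index i < r i" "r i \<le> last_index (Suc i)" for i
    using last_index_less[of i] by (auto simp: r_def)
  have "strict_mono r"
    by (rule strict_monoI_Suc) (use r_bounds le_less_trans in blast)
  moreover have "r k \<ge> 1" for k using r_bounds[of k] by simp
  moreover have "(\<lambda>k. real (s (r k)) / real (r k)) \<longlonglongrightarrow> l"
  proof -
    have pow: "filterlim (\<lambda>i. real p ^ Suc i) at_infinity sequentially"
      using filterlim_compose[OF filterlim_realpow_sequentially_gt1[of "real p"] filterlim_Suc] p_ge_2
      by simp
    have inv_pow: "(\<lambda>i. 1 / real p ^ Suc i) \<longlonglongrightarrow> 0"
      by (rule tendsto_divide_0[OF tendsto_const pow])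
    have ceil: "(\<lambda>i. real (nat \<lceil>x * real p ^ Suc i\<rceil>) / real p ^ Suc i) \<longlonglongrightarrow> x"
    proof (rule tendsto_sandwich)
      have c: "x * real p ^ Suc i \<le> real (nat \<lceil>x * real p ^ Suc i\<rceil>)"
        "real (nat \<lceil>x * real p ^ Suc i\<rceil>) \<le> x * real p ^ Suc i + 1" for i
      proof -
        have "0 \<le> x * real p ^ Suc i" using x0 p_pos by simp
        thus "x * real p ^ Suc i \<le> real (nat \<lceil>x * real p ^ Suc i\<rceil>)"
          "real (nat \<lceil>x * real p ^ Suc i\<rceil>) \<le> x * real p ^ Suc i + 1"
          by linarith+
      qed
      show "\<forall>\<^sub>F i in sequentially. x \<le> real (nat \<lceil>x * real p ^ Suc i\<rceil>) / real p ^ Suc i"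
        using c(1) p_pos by (intro always_eventually allI) (simp only: pos_le_divide_eq zero_less_power)
      show "\<forall>\<^sub>F i in sequentially. real (nat \<lceil>x * real p ^ Suc i\<rceil>) / real p ^ Suc i
          \<le> x + 1 / real p ^ Suc i"
      proof (intro always_eventually allI)
        fix i
        have "real (nat \<lceil>x * real p ^ Suc i\<rceil>) / real p ^ Suc i \<le> (x * real p ^ Suc i + 1) / real p ^ Suc i"
          by (rule divide_right_mono[OF c(2)]) simp
        also have "\<dots> = x + 1 / real p ^ Suc i" using p_pos by (simp add: add_divide_distrib)
        finally show "real (nat \<lceil>x * real p ^ Suc i\<rceil>) / real p ^ Suc i \<le> x + 1 / real p ^ Suc i" .
      qed
      show "(\<lambda>i. x + 1 / real p ^ Suc i) \<longlonglongrightarrow> x"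
        using tendsto_add[OF tendsto_const inv_pow, of x] by simp
    qed simp
    have suc: "(\<lambda>i. real (Suc (last_index i)) / real p ^ Suc i) \<longlonglongrightarrow> limit_density / real p"
    proof -
      have "(\<lambda>i. density i / real p + 1 / real p ^ Suc i) \<longlonglongrightarrow> limit_density / real p + 0"
        using p_pos by (intro tendsto_add inv_pow tendsto_divide density_tendsto tendsto_const) auto
      moreover have "density i / real p + 1 / real p ^ Suc i = real (Suc (last_index i)) / real p ^ Suc i" for i
        using p_pos by (simp add: density_def field_simps)
      ultimately show ?thesis by simp
    qed
    have "(\<lambda>i. min (density (Suc i)) (max (real (Suc (last_index i)) / real p ^ Suc i)
        (real (nat \<lceil>x * real p ^ Suc i\<rceil>) / real p ^ Suc i))) \<longlonglongrightarrow> x"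
      using tendsto_min[OF LIMSEQ_Suc[OF density_tendsto] tendsto_max[OF suc ceil]]
      unfolding x_clamp .
    moreover have "min (density (Suc i)) (max (real (Suc (last_index i)) / real p ^ Suc i)
        (real (nat \<lceil>x * real p ^ Suc i\<rceil>) / real p ^ Suc i)) = real (r i) / real p ^ Suc i" for i
      using p_pos unfolding density_def r_def
      by (simp only: of_nat_min of_nat_max min_divide_distrib_right max_divide_distrib_right
          zero_le_power less_imp_le if_True)
    ultimately have "(\<lambda>i. real (r i) / real p ^ Suc i) \<longlonglongrightarrow> x" by simp
    hence "(\<lambda>i. real (s 1) / (real (r i) / real p ^ Suc i)) \<longlonglongrightarrow> real (s 1) / x"
      using x0 by (intro tendsto_intros) auto
    moreover have "real (s 1) / x = l" using s_1_pos l0 by (simp add: x_def)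
    moreover have "real (s 1) / (real (r i) / real p ^ Suc i) = real (s (r i)) / real (r i)" for i
      using s_between[OF r_bounds] by simp
    ultimately show ?thesis by (simp only:)
  qed
  ultimately show "l \<in> limit_points (\<lambda>n. real (s n) / real n)"
    unfolding limit_points_def by blast
qed

text \<open>For (iv): since t lies between s and p s, the lower bound survives unchanged and the
  upper bound gains one factor p.\<close>

lemma ratio_multiples:
  assumes t: "\<And>n. 1 \<le> n \<Longrightarrow> t n \<in> {s n, p * s n}"
  shows "bounded ((\<lambda>n. real (t n) / real n) ` {1..})"
    and "limit_points (\<lambda>n. real (t n) / real n) \<subseteq> {ratio_const..(real p)\<^sup>2 * ratio_const}"
proof -
  have le: "real (s n) / real n \<le> real (t n) / real n"
    "real (t n) / real n \<le> real p * (real (s n) / real n)" if "1 \<le> n" for n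
  proof -
    have "s n \<le> t n \<and> t n \<le> p * s n" using t[OF that] p_ge_2 by auto
    hence "real (s n) \<le> real (t n)" "real (t n) \<le> real p * real (s n)"
      by (simp_all only: of_nat_le_iff flip: of_nat_mult)
    thus "real (s n) / real n \<le> real (t n) / real n"
      "real (t n) / real n \<le> real p * (real (s n) / real n)"
      unfolding times_divide_eq_right by (auto intro: divide_right_mono)
  qed
  obtain M where M: "real (s n) / real n \<le> M" if "1 \<le> n" for n
    using ratio_bounded unfolding bounded_iff by (auto simp: abs_le_iff)
  show "bounded ((\<lambda>n. real (t n) / real n) ` {1..})"
  proof (rule boundedI)
    fix y assume "y \<in> (\<lambda>n. real (t n) / real n) ` {1..}"
    then obtain n where n: "1 \<le> n" "y = real (t n) / real n" by auto
    have "real p * (real (s n) / real n) \<le> real p * M" using M[OF n(1)] p_pos by (intro mult_left_mono) auto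
    thus "norm y \<le> real p * M" using le(2)[OF n(1)] n(2) by simp
  qed
  show "limit_points (\<lambda>n. real (t n) / real n) \<subseteq> {ratio_const..(real p)\<^sup>2 * ratio_const}"
  proof
    fix l assume l: "l \<in> limit_points (\<lambda>n. real (t n) / real n)"
    have lower: "ratio_const \<le> real (t n) / real n" if "1 \<le> n" for n
      using ratio_const_le[OF that] le(1)[OF that] by linarith
    have upper: "real (t n) / real n \<le> real p * (real p * real (s 1)) / density i" if n: "last_index i < n" for i n
    proof -
      have "real (t n) / real n \<le> real p * (real (s n) / real n)" using n by (intro le(2)) simp
      also have "\<dots> \<le> real p * (real p * real (s 1) / density i)"
        using ratio_less[OF n] p_pos by (intro mult_left_mono) auto
      finally show ?thesis by simp
    qed
    show "l \<in> {ratio_const..(real p)\<^sup>2 * ratio_const}"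
      using limit_point_bounds[OF l lower upper] by (simp add: ratio_const_def power2_eq_square mult.assoc)
  qed
qed

section \<open>The extremal case c_A = s_A(1) / s_0\<close>

lemma first_level: "{j. j > 0 \<and> s j = s 1} = {n. 1 \<le> n \<and> s n \<le> s 1 * p ^ 0}"
  using s_mono[of 1] by (auto simp: Suc_le_eq intro: antisym)

lemma ratio_const_le_first: "ratio_const \<le> real (s 1) / real (last_index 0)"
  using ratio_const_le[OF last_index_in(1), of 0] s_le_last_index_0[OF last_index_in(1), of 0] by simp

text \<open>Equality says that L is the first density, and a nondecreasing sequence whose limit is
  its first term is constant.\<close>

lemma ratio_const_eq_iff:
  "ratio_const = real (s 1) / real (last_index 0) \<longleftrightarrow> (\<forall>i. last_index i = p ^ i * last_index 0)"
proof -
  have "ratio_const = real (s 1) / real (last_index 0) \<longleftrightarrow> limit_density = density 0"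
    using s_1_pos limit_density_pos density_pos[of 0]
    by (auto simp: ratio_const_def density_def field_simps)
  also have "\<dots> \<longleftrightarrow> (\<forall>i. density i = density 0)"
  proof
    assume "limit_density = density 0"
    thus "\<forall>i. density i = density 0"
      using density_le_limit incseq_density by (metis antisym incseq_def le0)
  next
    assume "\<forall>i. density i = density 0"
    hence "density = (\<lambda>_. density 0)" by blast
    hence "density \<longlonglongrightarrow> density 0" by (metis tendsto_const)
    thus "limit_density = density 0" using density_tendsto LIMSEQ_unique by blast
  qed
  also have "\<dots> \<longleftrightarrow> (\<forall>i. last_index i = p ^ i * last_index 0)"
  proof (rule iff_allI)
    fix i
    have "density i = density 0 \<longleftrightarrow> real (last_index i) = real (p ^ i * last_index 0)"
      using p_pos by (simp add: density_def field_simps)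
    thus "density i = density 0 \<longleftrightarrow> last_index i = p ^ i * last_index 0" by (simp only: of_nat_eq_iff)
  qed
  finally show ?thesis .
qed

text \<open>Here the block containing n is described by p^i < n / n_0 \<le> p^(i+1), so the ceiling
  of the logarithm is i + 1.\<close>

lemma s_extremal:
  assumes "\<And>i. last_index i = p ^ i * last_index 0" and n: "n > last_index 0"
  shows "s n = s 1 * p ^ nat \<lceil>log (real p) (real n / real (last_index 0))\<rceil>"
proof -
  obtain i where i: "last_index i < n" "n \<le> last_index (Suc i)" using between_ex[OF n] by blast
  define y where "y = real n / real (last_index 0)"
  have l0: "real (last_index 0) > 0" using last_index_in(1)[of 0] by simp
  have y0: "y > 0" using l0 n by (simp add: y_def)
  have p1: "real p > 1" using p_ge_2 by simp
  have "real (p ^ i * last_index 0) < real n" "real n \<le> real (p ^ Suc i * last_index 0)"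
    using i assms(1) by (metis of_nat_less_iff of_nat_le_iff)+
  hence "real p ^ i < y" "y \<le> real p ^ Suc i"
    using l0 by (simp_all add: y_def field_simps)
  hence "real i < log (real p) y" "log (real p) y \<le> real (Suc i)"
    using y0 p1 by (simp_all add: less_log_iff log_le_iff powr_realpow[symmetric] del: power_Suc)
  hence "\<lceil>log (real p) y\<rceil> = int (Suc i)" by (intro ceiling_unique) auto
  thus ?thesis using s_between[OF i] unfolding y_def by (simp only: nat_int)
qed

end

lemma strict_mono_times: "strict_mono r \<Longrightarrow> k \<ge> 1 \<Longrightarrow> strict_mono (\<lambda>j. k * r j)" for r :: "nat \<Rightarrow> nat"
  by (simp add: strict_mono_def)

text \<open>Along multiples of k, a limit point l of s(k n) / n gives the limit point l / k of s(n)
  / n. Thus one interval, scaled by 1 / k, lies in the other. Both have right end p times their left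
  end, so the left ends give one inequality and the right ends the reverse one.\<close>

lemma ratio_const_multiple:
  assumes "growth_sequence s p C" and k: "k \<ge> 1" and "growth_sequence (\<lambda>n. s (k * n)) p C'"
  shows "growth_sequence.ratio_const (\<lambda>n. s (k * n)) p = real k * growth_sequence.ratio_const s p"
proof -
  interpret S: growth_sequence s p C by fact
  interpret T: growth_sequence "\<lambda>n. s (k * n)" p C' by fact
  have sub: "l / real k \<in> {S.ratio_const..real p * S.ratio_const}"
    if l: "l \<in> {T.ratio_const..real p * T.ratio_const}" for l
  proof -
    obtain r :: "nat \<Rightarrow> nat" where r: "strict_mono r" "\<And>j. r j \<ge> 1"
      and lim: "(\<lambda>j. real (s (k * r j)) / real (r j)) \<longlonglongrightarrow> l"
      using l unfolding T.limit_points_ratio[symmetric] limit_points_def by auto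
    have "(\<lambda>j. real (s (k * r j)) / real (r j) / real k) \<longlonglongrightarrow> l / real k"
      using k by (intro tendsto_intros lim) auto
    moreover have "real (s (k * r j)) / real (r j) / real k = real (s (k * r j)) / real (k * r j)" for j
      by simp
    moreover have "k * r j \<ge> 1" for j using k r(2)[of j] by simp
    ultimately have "l / real k \<in> limit_points (\<lambda>n. real (s n) / real n)"
      unfolding limit_points_def using strict_mono_times[OF r(1) k]
      by (intro CollectI exI[of _ "\<lambda>j. k * r j"]) (simp only: simp_thms)
    thus ?thesis by (simp only: S.limit_points_ratio)
  qed
  have le: "T.ratio_const \<le> real p * T.ratio_const" using T.ratio_const_pos T.p_ge_2 by simp
  have "S.ratio_const \<le> T.ratio_const / real k" using sub[of T.ratio_const] le by simp
  moreover have "real p * T.ratio_const / real k \<le> real p * S.ratio_const"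
    using sub[of "real p * T.ratio_const"] le by simp
  ultimately show ?thesis using k S.p_pos by (simp add: field_simps)
qed

section \<open>Commuting additive maps\<close>

definition period :: "('k \<Rightarrow> 'k) \<Rightarrow> 'k set \<Rightarrow> nat" where
  "period f Z = (LEAST s. s > 0 \<and> (\<forall>x\<in>Z. (f ^^ s) x = x))"

lemma funpow_fixed: "(f ^^ s) x = x \<Longrightarrow> (f ^^ (s * k)) x = x"
  by (induction k) (simp_all add: funpow_add add.commute)

context
  fixes f :: "'k \<Rightarrow> 'k" and Z :: "'k set"
  assumes inj: "inj f" and finite: "finite Z" and invariant: "f ` Z \<subseteq> Z"
begin

text \<open>Pigeonhole principle: the iterates restricted to \<open>Z\<close> are finitely many, so
  two of them agree, and injectivity cancels the smaller exponent.\<close>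

lemma period_exists: "\<exists>s>0. \<forall>x\<in>Z. (f ^^ s) x = x"
proof -
  have inv: "(f ^^ i) x \<in> Z" if "x \<in> Z" for i x
    using that invariant by (induction i) auto
  have "range (\<lambda>i. restrict (f ^^ i) Z) \<subseteq> Z \<rightarrow>\<^sub>E Z"
    using inv by auto
  hence "finite (range (\<lambda>i::nat. restrict (f ^^ i) Z))"
    using finite finite_PiE[of Z "\<lambda>_. Z"] finite_subset by blast
  hence "\<not> inj (\<lambda>i::nat. restrict (f ^^ i) Z)"
    using finite_imageD infinite_UNIV_nat by blast
  then obtain i j :: nat where "restrict (f ^^ i) Z = restrict (f ^^ j) Z" "i \<noteq> j"
    by (auto simp: inj_def)
  then obtain i j :: nat where ij: "restrict (f ^^ i) Z = restrict (f ^^ j) Z" "i < j"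
    by (metis linorder_neqE_nat)
  have "(f ^^ (j - i)) x = x" if "x \<in> Z" for x
  proof -
    have "(f ^^ i) ((f ^^ (j - i)) x) = (f ^^ j) x"
      using ij(2) by (simp flip: funpow_add comp_apply[of "f ^^ i"])
    also have "\<dots> = (f ^^ i) x" using fun_cong[OF ij(1), of x] that by simp
    finally show ?thesis using inj_fn[OF inj, of i] by (simp add: inj_eq)
  qed
  thus ?thesis using ij(2) by (intro exI[of _ "j - i"]) simp
qed

lemma period_pos: "period f Z > 0"
  and period_fixed: "x \<in> Z \<Longrightarrow> (f ^^ period f Z) x = x"
  using LeastI_ex[OF period_exists] unfolding period_def by blast+

text \<open>Division with remainder: the remainder of an exponent fixing \<open>Z\<close> also fixes
  \<open>Z\<close> and is below the least positive one.\<close>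

lemma period_dvd_iff: "period f Z dvd t \<longleftrightarrow> (\<forall>x\<in>Z. (f ^^ t) x = x)"
proof
  assume "period f Z dvd t"
  thus "\<forall>x\<in>Z. (f ^^ t) x = x" using funpow_fixed period_fixed by (metis dvdE)
next
  assume t: "\<forall>x\<in>Z. (f ^^ t) x = x"
  have "(f ^^ (t mod period f Z)) x = x" if "x \<in> Z" for x
  proof -
    have "(f ^^ (t mod period f Z + period f Z * (t div period f Z))) x = x" using t that by simp
    thus ?thesis by (simp only: funpow_add comp_apply funpow_fixed[OF period_fixed[OF that]])
  qed
  moreover have "t mod period f Z < period f Z" using period_pos by simp
  ultimately have "t mod period f Z = 0"
    using not_less_Least[of "t mod period f Z" "\<lambda>s. s > 0 \<and> (\<forall>x\<in>Z. (f ^^ s) x = x)", folded period_def]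
    by (metis gr0I)
  thus "period f Z dvd t" by blast
qed

end

section \<open>Powers of an additive map minus the identity\<close>

lemma additive_funpow:
  fixes f :: "'k::ab_group_add \<Rightarrow> 'k"
  shows "Modules.additive f \<Longrightarrow> Modules.additive (f ^^ n)"
  by (induction n) (simp_all add: Modules.additive_def)

lemma additive_displacement: "Modules.additive f \<Longrightarrow> Modules.additive (\<lambda>x. f x - x)"
  by (simp add: Modules.additive_def)

text \<open>The binomial theorem for the operator f = 1 + N with N = f - 1, proved by Pascal's rule
  after splitting off the term for i = 0.\<close>

lemma funpow_binomial:
  fixes f :: "'k::comm_ring_1 \<Rightarrow> 'k"
  assumes "Modules.additive f"
  shows "(f ^^ k) x = (\<Sum>i\<le>k. of_nat (k choose i) * ((\<lambda>x. f x - x) ^^ i) x)"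
proof (induction k arbitrary: x)
  case 0
  show ?case by simp
next
  case (Suc k)
  let ?N = "\<lambda>x. f x - x"
  have "(f ^^ Suc k) x = (f ^^ k) (x + ?N x)" by (simp add: funpow_swap1)
  also have "\<dots> = (f ^^ k) x + (f ^^ k) (?N x)"
    using additive_funpow[OF assms] Modules.additive.add by blast
  also have "(f ^^ k) x = (?N ^^ 0) x + (\<Sum>i\<le>k. of_nat (k choose Suc i) * (?N ^^ Suc i) x)"
  proof -
    have "(f ^^ k) x = (\<Sum>i\<le>Suc k. of_nat (k choose i) * (?N ^^ i) x)"
      using Suc.IH[of x] by (simp add: binomial_eq_0)
    thus ?thesis by (simp only: sum.atMost_Suc_shift binomial_n_0 of_nat_1 mult_1_left)
  qed
  also have "(f ^^ k) (?N x) = (\<Sum>i\<le>k. of_nat (k choose i) * (?N ^^ Suc i) x)"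
    unfolding Suc.IH[of "?N x"] by (simp only: funpow_Suc_right comp_apply)
  also have "(?N ^^ 0) x + (\<Sum>i\<le>k. of_nat (k choose Suc i) * (?N ^^ Suc i) x)
      + (\<Sum>i\<le>k. of_nat (k choose i) * (?N ^^ Suc i) x)
      = (\<Sum>i\<le>Suc k. of_nat (Suc k choose i) * (?N ^^ i) x)"
    by (simp only: sum.atMost_Suc_shift binomial_Suc_Suc of_nat_add distrib_right sum.distrib)
       (simp add: ac_simps)
  finally show ?case .
qed

text \<open>The inner binomial coefficients are divisible by p, so the expansion of (1 + N)^p
  reduces to 1 + N^p.\<close>

lemma displacement_funpow_prime:
  fixes f :: "'k::comm_ring_1 \<Rightarrow> 'k"
  assumes "Modules.additive f" "Factorial_Ring.prime p" "of_nat p = (0 :: 'k)"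
  shows "((\<lambda>x. f x - x) ^^ p) x = (f ^^ p) x - x"
proof -
  have p: "p \<ge> 2" using assms(2) by (rule prime_ge_2_nat)
  define g where "g i = of_nat (p choose i) * ((\<lambda>x. f x - x) ^^ i) x" for i
  have "g i = 0" if "i \<in> {..p} - {0, p}" for i
  proof -
    have "p dvd (p choose i)" using that assms(2) by (intro dvd_choose_prime) auto
    hence "of_nat (p choose i) = (0 :: 'k)" using assms(3) by (auto elim!: dvdE)
    thus ?thesis by (simp add: g_def)
  qed
  hence "sum g {..p} = sum g {0, p}" by (intro sum.mono_neutral_right) auto
  also have "\<dots> = x + ((\<lambda>x. f x - x) ^^ p) x" using p by (simp add: g_def)
  finally show ?thesis unfolding funpow_binomial[OF assms(1), of p x] g_def by simp
qed

lemma displacement_funpow_prime_power: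
  fixes f :: "'k::comm_ring_1 \<Rightarrow> 'k"
  assumes "Modules.additive f" "Factorial_Ring.prime p" "of_nat p = (0 :: 'k)"
  shows "((\<lambda>x. f x - x) ^^ (p ^ i)) = (\<lambda>x. (f ^^ (p ^ i)) x - x)"
proof (induction i)
  case (Suc i)
  have "((\<lambda>x. f x - x) ^^ (p ^ Suc i)) = (((\<lambda>x. f x - x) ^^ (p ^ i)) ^^ p)"
    by (simp add: funpow_mult mult.commute)
  also have "\<dots> = ((\<lambda>x. (f ^^ (p ^ i)) x - x) ^^ p)" by (simp only: Suc.IH)
  also have "\<dots> = (\<lambda>x. ((f ^^ (p ^ i)) ^^ p) x - x)"
    using displacement_funpow_prime[OF additive_funpow[OF assms(1)] assms(2,3)] by blast
  also have "((f ^^ (p ^ i)) ^^ p) = (f ^^ (p ^ Suc i))" by (simp add: funpow_mult mult.commute)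
  finally show ?case .
qed simp

lemma funpow_commute: "(\<And>x. f (g x) = g (f x)) \<Longrightarrow> (f ^^ m) ((g ^^ n) x) = (g ^^ n) ((f ^^ m) x)"
proof -
  assume fg: "\<And>x. f (g x) = g (f x)"
  have "f ((g ^^ n) x) = (g ^^ n) (f x)" for x n by (induction n) (simp_all add: fg)
  thus ?thesis by (induction m) simp_all
qed

text \<open>In the application \<open>\<sigma>\<close> is the Frobenius map and \<open>a\<close> the evaluation of \<open>A\<close> on the algebraic closure.\<close>

locale commuting_additive_maps =
  fixes p q :: nat and \<sigma> a :: "'k::comm_ring_1 \<Rightarrow> 'k"
  assumes prime_p: "Factorial_Ring.prime p" and char_p: "of_nat p = (0 :: 'k)"
    and add_\<sigma>: "Modules.additive \<sigma>" and add_a: "Modules.additive a"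
    and commute: "\<sigma> (a x) = a (\<sigma> x)"
    and inj_\<sigma>: "inj \<sigma>" and surj_a: "surj a"
    and finite_kernel: "finite {x. a x = 0}" and kernel: "\<exists>x. x \<noteq> 0 \<and> a x = 0"
    and fixed_points: "s > 0 \<Longrightarrow> finite {x. (\<sigma> ^^ s) x = x} \<and> card {x. (\<sigma> ^^ s) x = x} \<le> q ^ s"
begin

lemma p_ge_2: "p \<ge> 2" using prime_p by (rule prime_ge_2_nat)

lemma add_an: "Modules.additive (a ^^ n)" by (rule additive_funpow[OF add_a])
lemma add_\<sigma>n: "Modules.additive (\<sigma> ^^ n)" by (rule additive_funpow[OF add_\<sigma>])

lemma surj_an: "surj (a ^^ n)"
  using surj_a by (simp add: surj_fn)

lemma \<sigma>_an: "(\<sigma> ^^ s) ((a ^^ n) x) = (a ^^ n) ((\<sigma> ^^ s) x)"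
  by (rule funpow_commute) (rule commute)

section \<open>Iterated kernels and the order of \<sigma> on them\<close>

definition V :: "nat \<Rightarrow> 'k set" where "V n = {x. (a ^^ n) x = 0}"

lemma in_V_iff: "x \<in> V n \<longleftrightarrow> (a ^^ n) x = 0" by (simp add: V_def)

lemma zero_in_V: "0 \<in> V n" using Modules.additive.zero[OF add_an] by (simp add: V_def)

lemma V_shift: "(a ^^ m) x \<in> V n \<longleftrightarrow> x \<in> V (m + n)"
  by (simp add: V_def add.commute[of m] funpow_add)

lemma V_mono: "V m \<subseteq> V (m + n)"
  using Modules.additive.zero[OF add_an]
  by (auto simp: V_def add.commute[of m] funpow_add)

text \<open>\<open>V (Suc n)\<close> is the disjoint union of the fibres of \<open>a\<close> over
  \<open>V n\<close>, and by surjectivity each fibre is a translate of the kernel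
  \<open>V 1\<close>.\<close>

lemma V_Suc: "finite (V n) \<Longrightarrow> finite (V (Suc n)) \<and> card (V (Suc n)) = card (V n) * card (V 1)"
proof -
  assume fin: "finite (V n)"
  have eq: "V (Suc n) = (\<Union>y\<in>V n. {x. a x = y})"
    using V_shift[of 1 _ n] by auto
  have fibre: "finite {x. a x = y} \<and> card {x. a x = y} = card (V 1)" for y
  proof -
    obtain w where w: "a w = y" using surj_a by (metis surjD)
    have "bij_betw (\<lambda>v. w + v) (V 1) {x. a x = y}"
      by (rule bij_betw_byWitness[of _ "\<lambda>x. x - w"])
         (use w add_a in \<open>auto simp: V_def Modules.additive.add Modules.additive.diff\<close>)
    moreover have "finite (V 1)" using finite_kernel by (simp add: V_def)
    ultimately show ?thesis by (metis bij_betw_finite bij_betw_same_card)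
  qed
  have "card (V (Suc n)) = (\<Sum>y\<in>V n. card {x. a x = y})"
    unfolding eq using fin fibre by (intro card_UN_disjoint) auto
  thus ?thesis using fibre fin by (simp add: eq)
qed

lemma V_0: "V 0 = {0}" by (auto simp: V_def)

lemma finite_V: "finite (V n)"
  by (induction n) (use V_Suc V_0 in auto)

lemma card_V: "2 ^ n \<le> card (V n)"
proof (induction n)
  case (Suc n)
  obtain x where x: "x \<noteq> 0" "a x = 0" using kernel by blast
  have "card {0, x} \<le> card (V 1)"
    using x zero_in_V[of 1] by (intro card_mono finite_V) (auto simp: V_def)
  hence "2 \<le> card (V 1)" using x(1) by simp
  hence "2 ^ n * 2 \<le> card (V n) * card (V 1)" using Suc mult_le_mono by blast
  thus ?case using V_Suc[OF finite_V, of n] by (simp only: power_Suc2)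
qed (simp add: V_0)

lemma \<sigma>_V: "\<sigma> ` V n \<subseteq> V n"
  using Modules.additive.zero[OF add_\<sigma>] by (auto simp: V_def simp flip: \<sigma>_an[of 1 n, simplified])

definition ord :: "nat \<Rightarrow> nat" where "ord n = period \<sigma> (V n)"

lemmas ord_pos = period_pos[OF inj_\<sigma> finite_V \<sigma>_V, folded ord_def]
lemmas ord_fixed = period_fixed[OF inj_\<sigma> finite_V \<sigma>_V, folded ord_def]
lemmas ord_dvd_iff = period_dvd_iff[OF inj_\<sigma> finite_V \<sigma>_V, folded ord_def]

lemma ord_dvd_mono: "m \<le> n \<Longrightarrow> ord m dvd ord n"
  unfolding ord_dvd_iff using V_mono[of m "n - m"] ord_fixed[of _ n] by auto

abbreviation N :: "nat \<Rightarrow> 'k \<Rightarrow> 'k" where "N s \<equiv> \<lambda>x. (\<sigma> ^^ s) x - x"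

lemma add_N: "Modules.additive (N s)" by (rule additive_displacement[OF add_\<sigma>n])

lemma N_an: "N s ((a ^^ n) x) = (a ^^ n) (N s x)"
  by (simp add: \<sigma>_an Modules.additive.diff[OF add_an])

lemma N_funpow: "((N s) ^^ (p ^ i)) x = N (s * p ^ i) x"
  unfolding displacement_funpow_prime_power[OF add_\<sigma>n prime_p char_p]
  by (simp add: funpow_mult)

text \<open>\<open>N (ord n)\<close> vanishes on \<open>V n\<close> and commutes with
  \<open>a\<close>, so each application lowers the kernel index by n.\<close>

lemma N_ord_V: "x \<in> V (k * n) \<Longrightarrow> ((N (ord n)) ^^ k) x = 0"
proof (induction k arbitrary: x)
  case 0
  thus ?case by (simp add: V_0)
next
  case (Suc k)
  have "(a ^^ (k * n)) x \<in> V n" using Suc.prems by (simp add: V_shift add.commute)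
  hence "N (ord n) ((a ^^ (k * n)) x) = 0" using ord_fixed by simp
  hence "N (ord n) x \<in> V (k * n)" by (simp only: N_an in_V_iff)
  thus ?case using Suc.IH by (simp only: funpow_Suc_right comp_apply)
qed

lemma period_cases:
  assumes "ord n dvd s" "s dvd ord n * p"
  shows "s \<in> {ord n, p * ord n}"
proof -
  obtain d where d: "s = ord n * d" using assms(1) by blast
  hence "d dvd p" using assms(2) ord_pos[of n] by simp
  hence "d = 1 \<or> d = p" using prime_p by (simp add: prime_nat_iff)
  thus ?thesis using d by (auto simp: mult.commute)
qed

text \<open>The p-th power of \<open>N (ord n)\<close> vanishes on \<open>V (n * p)\<close>, and in
  characteristic p it is \<open>N (ord n * p)\<close>.\<close>

lemma ord_mult_dvd: "ord (n * p) dvd ord n * p"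
  unfolding ord_dvd_iff
proof
  fix x assume "x \<in> V (n * p)"
  hence "((N (ord n)) ^^ p) x = 0" by (intro N_ord_V) (simp add: mult.commute)
  hence "N (ord n * p) x = 0" using N_funpow[where s = "ord n" and i = 1 and x = x] by simp
  thus "(\<sigma> ^^ (ord n * p)) x = x" by simp
qed

lemma ord_mult: "ord (n * p) \<in> {ord n, p * ord n}"
  using p_ge_2 by (intro period_cases ord_mult_dvd ord_dvd_mono) simp

text \<open>\<open>ord n\<close> is a multiple of \<open>ord 1\<close> and divides
  \<open>ord (p ^ k)\<close>, hence \<open>ord 1 * p ^ k\<close>. The cofactor therefore divides
  p^k.\<close>

lemma ord_power: "n \<ge> 1 \<Longrightarrow> n \<le> p ^ k \<Longrightarrow> \<exists>i\<le>k. ord n = ord 1 * p ^ i"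
proof -
  assume n: "n \<ge> 1" "n \<le> p ^ k"
  have "ord (p ^ k) dvd ord 1 * p ^ k"
  proof (induction k)
    case (Suc k)
    have "ord (p ^ Suc k) dvd ord (p ^ k) * p" using ord_mult_dvd[of "p ^ k"] by (simp add: mult.commute)
    also have "\<dots> dvd ord 1 * p ^ k * p" using Suc by (intro mult_dvd_mono) auto
    finally show ?case by (simp add: mult_ac)
  qed simp
  hence "ord n dvd ord 1 * p ^ k" using ord_dvd_mono[OF n(2)] dvd_trans by blast
  moreover obtain d where d: "ord n = ord 1 * d" using ord_dvd_mono[OF n(1)] by blast
  ultimately have "d dvd p ^ k" using ord_pos[of 1] by simp
  then obtain i where "i \<le> k" "d = p ^ i" using divides_primepow_nat[OF prime_p] by blast
  thus ?thesis using d by blast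
qed

lemma ord_power_ex: "n \<ge> 1 \<Longrightarrow> \<exists>i. ord n = ord 1 * p ^ i"
proof -
  assume "n \<ge> 1"
  moreover have "n \<le> p ^ n" using power_gt_expt[of p n] p_ge_2 by linarith
  ultimately show ?thesis using ord_power by blast
qed

text \<open>\<open>V n\<close> has at least 2^n elements, all fixed by
  \<open>\<sigma> ^^ ord n\<close>. The crude bound q < 2^q replaces a logarithm and explains the
  constant q.\<close>

lemma ord_linear: "n \<le> q * ord n"
proof -
  have "2 ^ n \<le> card (V n)" by (rule card_V)
  also have "\<dots> \<le> card {x. (\<sigma> ^^ ord n) x = x}"
  proof (rule card_mono)
    show "finite {x. (\<sigma> ^^ ord n) x = x}" using fixed_points[OF ord_pos] by blast
    show "V n \<subseteq> {x. (\<sigma> ^^ ord n) x = x}" using ord_fixed by blast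
  qed
  also have "\<dots> \<le> q ^ ord n" using fixed_points[OF ord_pos] by blast
  also have "\<dots> \<le> (2 ^ q) ^ ord n" by (rule power_mono[OF less_imp_le[OF less_exp]]) simp
  finally have "(2::nat) ^ n \<le> 2 ^ (q * ord n)" by (simp add: power_mult)
  thus ?thesis by (rule power_le_imp_le_exp[rotated]) simp
qed

end

context commuting_additive_maps begin

text \<open>The case k = 1 concerns A itself; general k is for (v), because the n-th kernel of the
  k-fold iterate is \<open>V (k * n)\<close>.\<close>

lemma growth_sequence_ord:
  assumes k: "k \<ge> 1"
  shows "growth_sequence (\<lambda>n. ord (k * n)) p q"
proof
  show "p \<ge> 2" by (rule p_ge_2)
  show "ord (k * 1) > 0" by (rule ord_pos)
  show "ord (k * m) \<le> ord (k * n)" if "m \<le> n" for m n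
    using ord_dvd_mono[of "k * m" "k * n"] that ord_pos by (intro dvd_imp_le) auto
  show "ord (k * (n * p)) \<le> p * ord (k * n)" for n
    using ord_mult_dvd[of "k * n"] ord_pos[of "k * n"] p_ge_2
    by (intro dvd_imp_le) (simp_all add: mult.assoc mult.commute[of p])
  show "n \<le> q * ord (k * n)" for n
  proof -
    have "n \<le> k * n" using k by simp
    also have "\<dots> \<le> q * ord (k * n)" by (rule ord_linear)
    finally show ?thesis .
  qed
  show "\<exists>i. ord (k * n) = ord (k * 1) * p ^ i" if "1 \<le> n" for n
  proof -
    obtain i where i: "ord (k * n) = ord 1 * p ^ i" using ord_power_ex[of "k * n"] k \<open>1 \<le> n\<close> by auto
    obtain j where j: "ord (k * 1) = ord 1 * p ^ j" using ord_power_ex[of "k * 1"] k by auto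
    have "ord (k * 1) dvd ord (k * n)" using \<open>1 \<le> n\<close> by (intro ord_dvd_mono) simp
    hence "p ^ j dvd p ^ i" using i j ord_pos[of 1] by simp
    hence "j \<le> i" using p_ge_2 by (simp add: dvd_power_iff_le)
    thus ?thesis unfolding i j by (intro exI[of _ "i - j"]) (simp add: power_add[symmetric])
  qed
qed

text \<open>\<open>g ^^ n\<close> differs from \<open>a ^^ n\<close> by a constant, so its zero set
  is a coset of \<open>V n\<close>. It is stable under \<sigma> because b is fixed. Differences of
  zeros run through \<open>V n\<close>, which gives the first divisibility.\<close>

lemma period_affine:
  fixes b :: 'k
  defines "g \<equiv> \<lambda>x. a x + b"
  assumes b: "\<sigma> b = b"
  shows "period \<sigma> {x. (g ^^ n) x = 0} \<in> {ord n, p * ord n}"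
proof -
  let ?Z = "{x. (g ^^ n) x = 0}"
  note add_simps = Modules.additive.add[OF add_an] Modules.additive.diff[OF add_an]
  have gn: "(g ^^ n) x = (a ^^ n) x + (g ^^ n) 0" for x n
    by (induction n) (simp_all add: g_def Modules.additive.add[OF add_a])
  have "\<sigma> (g x) = g (\<sigma> x)" for x
    by (simp add: g_def commute b Modules.additive.add[OF add_\<sigma>])
  hence \<sigma>g: "(\<sigma> ^^ s) ((g ^^ n) x) = (g ^^ n) ((\<sigma> ^^ s) x)" for s n x by (rule funpow_commute)
  have \<sigma>0: "(\<sigma> ^^ s) 0 = 0" for s by (rule Modules.additive.zero[OF add_\<sigma>n])
  obtain w where "(a ^^ n) w = - (g ^^ n) 0" using surj_an by (metis surjD)
  hence w: "w \<in> ?Z" using gn[of n w] by simp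
  have diff: "x - y \<in> V n" if "x \<in> ?Z" "y \<in> ?Z" for x y
  proof -
    have "(a ^^ n) x + (g ^^ n) 0 = (a ^^ n) y + (g ^^ n) 0"
      using that by (simp only: mem_Collect_eq flip: gn)
    hence "(a ^^ n) x = (a ^^ n) y" by (rule add_right_imp_eq)
    thus ?thesis by (simp add: V_def add_simps)
  qed
  have sum: "w + v \<in> ?Z" if "v \<in> V n" for v
    using w that gn[of n w] gn[of n "w + v"] by (simp add: V_def add_simps)
  have "?Z \<subseteq> (\<lambda>v. w + v) ` V n"
  proof
    fix x assume "x \<in> ?Z"
    thus "x \<in> (\<lambda>v. w + v) ` V n" using diff[OF _ w, of x] by (intro image_eqI[of _ _ "x - w"]) auto
  qed
  hence fin: "finite ?Z" using finite_V finite_surj by blast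
  have inv: "\<sigma> ` ?Z \<subseteq> ?Z"
  proof clarify
    fix x assume "(g ^^ n) x = 0"
    thus "(g ^^ n) (\<sigma> x) = 0" using \<sigma>g[of 1 n x] \<sigma>0[of 1] by simp
  qed
  note dvd_iff = period_dvd_iff[OF inj_\<sigma> fin inv]
  note fixed = period_fixed[OF inj_\<sigma> fin inv]
  have "ord n dvd period \<sigma> ?Z"
    unfolding ord_dvd_iff
  proof
    fix v assume "v \<in> V n"
    hence "(\<sigma> ^^ period \<sigma> ?Z) (w + v) = w + v" using fixed sum by blast
    thus "(\<sigma> ^^ period \<sigma> ?Z) v = v"
      using fixed[OF w] Modules.additive.add[OF add_\<sigma>n] by simp
  qed
  moreover have "period \<sigma> ?Z dvd ord n * p"
    unfolding dvd_iff
  proof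
    fix x assume x: "x \<in> ?Z"
    \<comment> \<open>The image is another zero, so \<open>N (ord n) x\<close> is a difference of
      zeros and lies in \<open>V n\<close>. Hence the square of \<open>N (ord n)\<close> vanishes at
      x, and so does its p-th power because p \<ge> 2.\<close>
    have "(\<sigma> ^^ ord n) x \<in> ?Z" using x \<sigma>g[of "ord n" n x] \<sigma>0 by simp
    hence "N (ord n) (N (ord n) x) = 0" using diff x ord_fixed by simp
    moreover have "((N (ord n)) ^^ p) x = ((N (ord n)) ^^ (p - 2)) (N (ord n) (N (ord n) x))"
    proof -
      have "((N (ord n)) ^^ p) = ((N (ord n)) ^^ (p - 2 + 2))" by (simp only: le_add_diff_inverse2[OF p_ge_2])
      thus ?thesis by (simp only: funpow_add) (simp add: numeral_2_eq_2)
    qed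
    ultimately have "((N (ord n)) ^^ p) x = 0"
      using Modules.additive.zero[OF additive_funpow[OF add_N]] by simp
    thus "(\<sigma> ^^ (ord n * p)) x = x" using N_funpow[where s = "ord n" and i = 1 and x = x] by simp
  qed
  ultimately show "period \<sigma> ?Z \<in> {ord n, p * ord n}" by (rule period_cases)
qed

lemma ord_power_log: "n \<ge> 1 \<Longrightarrow> \<exists>i::nat. real i < log (real p) (real n) + 1 \<and> ord n = ord 1 * p ^ i"
proof -
  assume n: "n \<ge> 1"
  have p1: "real p > 1" using p_ge_2 by simp
  \<comment> \<open>This k satisfies n \<le> p^k and still lies below log_p n + 1.\<close>
  define k where "k = nat \<lceil>log (real p) (real n)\<rceil>"
  have "log (real p) (real n) \<ge> 0" using n p1 by simp
  hence k: "log (real p) (real n) \<le> real k" "real k < log (real p) (real n) + 1"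
    unfolding k_def by linarith+
  have "real n \<le> real p powr real k" using k(1) n p1 by (simp add: log_le_iff)
  hence "real n \<le> real (p ^ k)" using p1 by (simp add: powr_realpow)
  hence "n \<le> p ^ k" by (simp only: of_nat_le_iff)
  then obtain i where "i \<le> k" "ord n = ord 1 * p ^ i" using ord_power n by blast
  thus ?thesis using k(2) by (intro exI[of _ i]) simp
qed

section \<open>Left factors \<open>B\<close> of \<sigma>^r N and their nilpotency\<close>

context
  fixes B :: "'k \<Rightarrow> 'k" and m r s :: nat
  assumes m: "m \<ge> 1" and s: "s = ord m" and B_0: "B 0 = 0"
    and B_an: "B ((a ^^ m) x) = (\<sigma> ^^ r) (N s x)"
begin

lemma \<sigma>N_an: "(\<sigma> ^^ r) (N s ((a ^^ n) x)) = (a ^^ n) ((\<sigma> ^^ r) (N s x))"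
  unfolding N_an by (rule \<sigma>_an)

text \<open>Every y has the form \<open>(a ^^ m) x\<close>, and the right-hand side of
  \<open>B_an\<close> commutes with \<open>a\<close>.\<close>

lemma B_a: "B (a y) = a (B y)"
proof -
  obtain x where x: "y = (a ^^ m) x" using surj_an by (metis surjD)
  have "B (a y) = B ((a ^^ m) (a x))" unfolding x by (simp add: funpow_swap1)
  also have "\<dots> = a (B y)" unfolding x B_an using \<sigma>N_an[of 1 x] by simp
  finally show ?thesis .
qed

lemma Bn_an: "(B ^^ j) ((a ^^ i) y) = (a ^^ i) ((B ^^ j) y)"
  by (rule funpow_commute) (rule B_a)

lemma Bn_0: "(B ^^ j) 0 = 0"
  by (induction j) (simp_all add: B_0)

text \<open>Each factor \<open>B\<close> absorbs one block \<open>a ^^ m\<close> and leaves a factor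
  \<sigma>^r N, which commutes with the remaining powers of \<open>a\<close> and of
  \<open>N s\<close>.\<close>

lemma Bn_iterate: "(B ^^ k) ((a ^^ (m * k)) x) = (\<sigma> ^^ (r * k)) ((N s ^^ k) x)"
proof (induction k arbitrary: x)
  case (Suc k)
  have "\<sigma> (N s x) = N s (\<sigma> x)" for x
    by (simp add: Modules.additive.diff[OF add_\<sigma>] funpow_swap1)
  hence N\<sigma>: "(N s ^^ k) ((\<sigma> ^^ r) x) = (\<sigma> ^^ r) ((N s ^^ k) x)" for x
    using funpow_commute[of \<sigma> "N s" r k x] by simp
  have "(B ^^ Suc k) ((a ^^ (m * Suc k)) x) = (B ^^ k) (B ((a ^^ m) ((a ^^ (m * k)) x)))"
    by (simp only: funpow_Suc_right mult_Suc_right funpow_add comp_apply)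
  also have "\<dots> = (B ^^ k) ((a ^^ (m * k)) ((\<sigma> ^^ r) (N s x)))"
    by (simp only: B_an \<sigma>N_an)
  also have "\<dots> = (\<sigma> ^^ (r * k)) ((N s ^^ k) ((\<sigma> ^^ r) (N s x)))" by (rule Suc.IH)
  also have "\<dots> = (\<sigma> ^^ (r * k)) ((\<sigma> ^^ r) ((N s ^^ k) (N s x)))" by (simp only: N\<sigma>)
  also have "\<dots> = (\<sigma> ^^ (r * Suc k)) ((N s ^^ Suc k) x)"
    by (simp only: funpow_Suc_right[of k "N s"] mult_Suc_right add.commute[of r] funpow_add comp_apply)
  finally show ?case .
qed simp

text \<open>With k = p^i, x is fixed by \<open>\<sigma> ^^ (s * k)\<close> exactly when
  \<open>B ^^ k\<close> vanishes at \<open>(a ^^ (m * k)) x\<close>, because \<sigma> is injective.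
  These points fill \<open>V 1\<close> as x runs through \<open>V (m * k + 1)\<close>. The index is
  the first one beyond m k.\<close>

lemma ord_dvd_iff_B: "ord (m * p ^ i + 1) dvd s * p ^ i \<longleftrightarrow> (\<forall>y\<in>V 1. (B ^^ (p ^ i)) y = 0)"
proof -
  let ?k = "p ^ i"
  have *: "(B ^^ ?k) ((a ^^ (m * ?k)) x) = 0 \<longleftrightarrow> (\<sigma> ^^ (s * ?k)) x = x" for x
  proof -
    have "(B ^^ ?k) ((a ^^ (m * ?k)) x) = (\<sigma> ^^ (r * ?k)) (N (s * ?k) x)"
      unfolding Bn_iterate N_funpow ..
    also have "\<dots> = 0 \<longleftrightarrow> N (s * ?k) x = 0"
      using inj_fn[OF inj_\<sigma>, of "r * ?k"] Modules.additive.zero[OF add_\<sigma>n, of "r * ?k"] by (metis injD)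
    finally show ?thesis by simp
  qed
  show ?thesis
    unfolding ord_dvd_iff
  proof safe
    fix y assume all: "\<forall>x\<in>V (m * ?k + 1). (\<sigma> ^^ (s * ?k)) x = x" and y: "y \<in> V 1"
    obtain x where x: "y = (a ^^ (m * ?k)) x" using surj_an by (metis surjD)
    show "(B ^^ ?k) y = 0" using all y unfolding x V_shift * by blast
  next
    fix x assume "\<forall>y\<in>V 1. (B ^^ ?k) y = 0" "x \<in> V (m * ?k + 1)"
    thus "(\<sigma> ^^ (s * ?k)) x = x" unfolding *[symmetric] V_shift[symmetric] by blast
  qed
qed

text \<open>Exponents may be enlarged to powers of p, since k \<le> p^k and \<open>B\<close> maps 0
  to 0.\<close>

lemma nilpotent_on_V_1_iff: "nilpotent_on (V 1) B \<longleftrightarrow> (\<exists>i. \<forall>y\<in>V 1. (B ^^ (p ^ i)) y = 0)"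
proof
  assume "nilpotent_on (V 1) B"
  then obtain k where k: "\<And>y. y \<in> V 1 \<Longrightarrow> (B ^^ k) y = 0" unfolding nilpotent_on_def by blast
  have "k \<le> p ^ k" using power_gt_expt[of p k] p_ge_2 by linarith
  then obtain d where "p ^ k = d + k" using le_Suc_ex by (metis add.commute)
  hence "(B ^^ (p ^ k)) y = 0" if "y \<in> V 1" for y
    using k[OF that] by (simp add: funpow_add Bn_0)
  thus "\<exists>i. \<forall>y\<in>V 1. (B ^^ (p ^ i)) y = 0" by blast
qed (auto simp: nilpotent_on_def)

text \<open>\<open>V 1\<close> lies in the fixed field. Conversely, if \<open>B ^^ k\<close>
  vanishes on \<open>V 1\<close>, it maps each \<open>V (Suc n)\<close> into \<open>V n\<close>, so
  some iterate vanishes on \<open>V m\<close>; and \<open>B\<close> maps the fixed field into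
  \<open>V m\<close> because \<sigma>^r N vanishes there.\<close>

lemma nilpotent_on_fixed_iff: "nilpotent_on {x. (\<sigma> ^^ s) x = x} B \<longleftrightarrow> nilpotent_on (V 1) B"
proof
  have "V 1 \<subseteq> V m" using V_mono[of 1 "m - 1"] m by simp
  hence "V 1 \<subseteq> {x. (\<sigma> ^^ s) x = x}" using ord_fixed[of _ m] unfolding s by blast
  thus "nilpotent_on {x. (\<sigma> ^^ s) x = x} B \<Longrightarrow> nilpotent_on (V 1) B"
    unfolding nilpotent_on_def by blast
next
  assume "nilpotent_on (V 1) B"
  then obtain k where k: "\<And>y. y \<in> V 1 \<Longrightarrow> (B ^^ k) y = 0" unfolding nilpotent_on_def by blast
  have Vn: "(B ^^ (k * n)) x = 0" if "x \<in> V n" for n x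
    using that
  proof (induction n arbitrary: x)
    case 0
    thus ?case by (simp add: V_0)
  next
    case (Suc n)
    have "(a ^^ n) x \<in> V 1" using Suc.prems by (simp add: V_shift)
    hence "(B ^^ k) x \<in> V n" using k by (simp add: V_def flip: Bn_an)
    hence "(B ^^ (k * n)) ((B ^^ k) x) = 0" by (rule Suc.IH)
    moreover have "k * Suc n = k * n + k" by simp
    ultimately show ?case by (simp only: funpow_add comp_apply)
  qed
  have "(B ^^ (k * m + 1)) x = 0" if "(\<sigma> ^^ s) x = x" for x
  proof -
    have "(a ^^ m) (B x) = B ((a ^^ m) x)" using Bn_an[of 1 m x] by simp
    also have "\<dots> = 0" using that Modules.additive.zero[OF add_\<sigma>n] by (simp add: B_an)
    finally have "B x \<in> V m" by (simp add: V_def)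
    thus ?thesis using Vn by (simp only: funpow_add comp_apply) simp
  qed
  thus "nilpotent_on {x. (\<sigma> ^^ s) x = x} B" unfolding nilpotent_on_def by blast
qed

end

text \<open>Always n_i \<ge> p^i m, so equality fails exactly when p^i m + 1 still belongs to level
  i. The left factor detects this by vanishing of \<open>B ^^ (p ^ i)\<close> on
  \<open>V 1\<close>.\<close>

lemma extremal_iff_not_nilpotent:
  assumes B: "B 0 = 0" "\<And>x. B ((a ^^ m) x) = (\<sigma> ^^ r) (N s x)"
    and m: "m = growth_sequence.last_index ord p 0" and s: "s = ord 1"
  shows "growth_sequence.ratio_const ord p = real s / real m \<longleftrightarrow>
    \<not> nilpotent_on {x. (\<sigma> ^^ s) x = x} B"
proof -
  interpret S: growth_sequence ord p q using growth_sequence_ord[of 1] by simp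
  have m1: "m \<ge> 1" unfolding m by (rule S.last_index_in)
  have sm: "s = ord m" unfolding s m using S.s_le_last_index_0[OF S.last_index_in(1)] by simp
  have le: "p ^ i * m \<le> S.last_index i" for i
  proof (induction i)
    case (Suc i)
    have "p ^ Suc i * m \<le> S.last_index i * p" using Suc by (simp add: mult_ac)
    thus ?case using S.last_index_mult[of i] by linarith
  qed (simp add: m)
  have "S.last_index i = p ^ i * m \<longleftrightarrow> \<not> (\<forall>y\<in>V 1. (B ^^ (p ^ i)) y = 0)" for i
  proof -
    have "S.last_index i = p ^ i * m \<longleftrightarrow> \<not> (m * p ^ i + 1 \<le> S.last_index i)"
      using le[of i] by (auto simp: mult.commute)
    also have "\<dots> \<longleftrightarrow> \<not> ord (m * p ^ i + 1) \<le> s * p ^ i"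
      by (subst S.le_last_index_iff) (simp_all add: s)
    \<comment> \<open>Both sides are s times a power of p, where order and divisibility
      coincide.\<close>
    also have "ord (m * p ^ i + 1) \<le> s * p ^ i \<longleftrightarrow> ord (m * p ^ i + 1) dvd s * p ^ i"
    proof
      assume le: "ord (m * p ^ i + 1) \<le> s * p ^ i"
      obtain j where j: "ord (m * p ^ i + 1) = s * p ^ j"
        using ord_power_ex[of "m * p ^ i + 1"] unfolding s by auto
      hence "j \<le> i" using le ord_pos[of 1] p_ge_2 by (simp add: s power_increasing_iff)
      thus "ord (m * p ^ i + 1) dvd s * p ^ i" unfolding j by (intro mult_dvd_mono le_imp_power_dvd) auto
    next
      assume "ord (m * p ^ i + 1) dvd s * p ^ i"
      thus "ord (m * p ^ i + 1) \<le> s * p ^ i" using ord_pos[of 1] p_ge_2 by (intro dvd_imp_le) (auto simp: s)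
    qed
    also have "\<dots> \<longleftrightarrow> (\<forall>y\<in>V 1. (B ^^ (p ^ i)) y = 0)"
      by (rule ord_dvd_iff_B[OF m1 sm B])
    finally show ?thesis .
  qed
  hence "(\<forall>i. S.last_index i = p ^ i * m) \<longleftrightarrow> \<not> nilpotent_on {x. (\<sigma> ^^ s) x = x} B"
    unfolding nilpotent_on_fixed_iff[OF m1 sm B] nilpotent_on_V_1_iff[OF m1 sm B] by blast
  thus ?thesis using S.ratio_const_eq_iff by (simp only: s m)
qed

end

section \<open>Additive polynomials\<close>

lemma pcompose_power: "pcompose (f ^ n) g = pcompose f g ^ n" for f g :: "'a::comm_semiring_1 poly"
  by (induction n) (simp_all add: pcompose_mult pcompose_1)

lemma freshmans_dream_diff:
  fixes x y :: "'a::comm_ring_1"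
  assumes "Factorial_Ring.prime CHAR('a)" "m = CHAR('a) ^ n"
  shows "(x - y) ^ m = x ^ m - y ^ m"
  using freshmans_dream'[OF assms, of "x - y" y] by simp

section \<open>Polynomials under a ring homomorphism of the coefficients\<close>

context
  fixes h :: "'a::comm_ring_1 \<Rightarrow> 'b::comm_ring_1"
  assumes h_0: "h 0 = 0" and h_1: "h 1 = 1"
    and h_add: "\<And>x y. h (x + y) = h x + h y" and h_mult: "\<And>x y. h (x * y) = h x * h y"
begin

lemma map_poly_hom_add: "map_poly h (f + g) = map_poly h f + map_poly h g"
  by (rule poly_eqI) (simp add: coeff_map_poly h_0 h_add)

lemma map_poly_hom_diff: "map_poly h (f - g) = map_poly h f - map_poly h g"
  using map_poly_hom_add[of "f - g" g] by simp

lemma map_poly_hom_mult: "map_poly h (f * g) = map_poly h f * map_poly h g"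
proof (induction f)
  case (pCons c f)
  have "map_poly h (Polynomial.smult c g) = Polynomial.smult (h c) (map_poly h g)"
    by (rule poly_eqI) (simp add: coeff_map_poly h_0 h_mult)
  thus ?case using pCons by (simp add: mult_pCons_left map_poly_hom_add map_poly_pCons h_0)
qed simp

lemma map_poly_hom_power: "map_poly h (f ^ n) = map_poly h f ^ n"
  by (induction n) (simp_all add: map_poly_hom_mult h_1)

lemma map_poly_hom_pcompose: "map_poly h (pcompose f g) = pcompose (map_poly h f) (map_poly h g)"
  by (induction f)
     (simp_all add: pcompose_pCons map_poly_hom_add map_poly_hom_mult map_poly_pCons h_0)

lemma poly_map_poly_sum:
  "poly (map_poly h f) x = (\<Sum>n\<le>Polynomial.degree f. h (Polynomial.coeff f n) * x ^ n)"
proof -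
  have "Polynomial.degree (map_poly h f) \<le> Polynomial.degree f"
    by (rule degree_le) (simp add: coeff_map_poly h_0 coeff_eq_0)
  hence "(\<Sum>n\<le>Polynomial.degree (map_poly h f). h (Polynomial.coeff f n) * x ^ n)
      = (\<Sum>n\<le>Polynomial.degree f. h (Polynomial.coeff f n) * x ^ n)"
    by (intro sum.mono_neutral_left) (auto simp: coeff_eq_0 simp flip: coeff_map_poly[of h, OF h_0])
  thus ?thesis by (simp add: poly_altdef coeff_map_poly h_0)
qed

lemma poly_map_poly_additive:
  assumes p: "Factorial_Ring.prime p" "CHAR('b) = p"
    and f: "\<And>n. Polynomial.coeff f n \<noteq> 0 \<Longrightarrow> \<exists>i. n = p ^ i"
  shows "poly (map_poly h f) (x + y) = poly (map_poly h f) x + poly (map_poly h f) y"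
proof -
  have "h (Polynomial.coeff f n) * (x + y) ^ n
      = h (Polynomial.coeff f n) * x ^ n + h (Polynomial.coeff f n) * y ^ n" for n
  proof (cases "Polynomial.coeff f n = 0")
    case False
    then obtain i where "n = p ^ i" using f by blast
    hence "(x + y) ^ n = x ^ n + y ^ n" using freshmans_dream'[of n i x y] p by simp
    thus ?thesis by (simp add: distrib_left)
  qed (simp add: h_0)
  thus ?thesis by (simp add: poly_map_poly_sum sum.distrib)
qed

end

text \<open>These are the linearized polynomials; over a field of characteristic p they are exactly
  the additive ones.\<close>

definition p_linear :: "nat \<Rightarrow> 'a::zero poly \<Rightarrow> bool" where
  "p_linear p f \<longleftrightarrow> (\<forall>n. Polynomial.coeff f n \<noteq> 0 \<longrightarrow> (\<exists>i. n = p ^ i))"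

lemma p_linear_diff: "p_linear p f \<Longrightarrow> p_linear p g \<Longrightarrow> p_linear p (f - g)"
  for f g :: "'a::ab_group_add poly"
  unfolding p_linear_def coeff_diff by (metis diff_zero)

lemma p_linear_add: "p_linear p f \<Longrightarrow> p_linear p g \<Longrightarrow> p_linear p (f + g)"
  for f g :: "'a::comm_monoid_add poly"
  unfolding p_linear_def coeff_add by (metis add_0)

lemma p_linear_monom: "p_linear p (Polynomial.monom c (p ^ i))"
  by (auto simp: p_linear_def)

lemma p_linear_0: "p_linear p 0"
  by (simp add: p_linear_def)

lemma p_linear_coeff_0: "p_linear p f \<Longrightarrow> p > 0 \<Longrightarrow> Polynomial.coeff f 0 = 0"
  by (auto simp: p_linear_def)

text \<open>Makes the facts on coefficient homomorphisms available for the embedding inside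
  \<open>additive_poly\<close>.\<close>

lemma hom_const_const:
  fixes x y :: "'a::comm_ring_1"
  shows "[:[:0:]:] = (0 :: 'a poly poly)" "[:[:1:]:] = (1 :: 'a poly poly)"
    "[:[:x + y:]:] = [:[:x:]:] + [:[:y:]:]" "[:[:x * y:]:] = [:[:x:]:] * [:[:y:]:]"
  by (simp_all add: one_pCons)

text \<open>Compare coefficients in f(U + V) = f(U) + f(V): mixed monomials occur only on the left,
  with a binomial factor.\<close>

lemma additive_poly_coeff:
  fixes f :: "'a::field poly"
  assumes "additive_poly f"
  shows "Polynomial.coeff f 0 = 0"
    and "k \<ge> 1 \<Longrightarrow> k < n \<Longrightarrow> of_nat (n choose k) * Polynomial.coeff f n = 0"
proof -
  define F where "F = map_poly (\<lambda>c. [:[:c:]:]) f"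
  define U V :: "'a poly poly" where "U = [:[:0, 1:]:]" and "V = [:0, 1:]"
  note F_sum = poly_map_poly_sum[of "\<lambda>c::'a. [:[:c:]:]" f, OF hom_const_const, folded F_def]
  have eq: "poly F (U + V) = poly F U + poly F V"
    using assms by (simp add: additive_poly_def Let_def F_def U_def V_def)
  \<comment> \<open>The outer index k belongs to \<open>V\<close>, the inner index j to
    \<open>U\<close>.\<close>
  define C :: "'a poly poly \<Rightarrow> nat \<Rightarrow> nat \<Rightarrow> 'a"
    where "C W k j = Polynomial.coeff (Polynomial.coeff W k) j" for W k j
  have C_add: "C (W + W') k j = C W k j + C W' k j" for W W' k j by (simp add: C_def)
  have C_F: "C (poly F W) k j = (\<Sum>n\<le>Polynomial.degree f. Polynomial.coeff f n * C (W ^ n) k j)" for W k j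
    by (simp add: F_sum C_def coeff_sum)
  have U_pow: "U ^ n = [:Polynomial.monom 1 n:]" for n
    by (induction n) (simp_all add: U_def monom_Suc one_pCons)
  have V_pow: "V ^ n = Polynomial.monom 1 n" for n
    by (simp add: V_def monom_altdef)
  \<comment> \<open>In \<open>f(U + V)\<close> the monomial \<open>U ^ j * V ^ k\<close> only arises from the term of degree \<open>k + j\<close>.\<close>
  have UV_pow: "C ((U + V) ^ n) k j = (if n = k + j then of_nat (n choose k) else 0)" for n k j
  proof -
    have UV: "U + V = [:[:0, 1:], 1:]" by (simp add: U_def V_def)
    have "Polynomial.coeff ((U + V) ^ n) k = of_nat (n choose k) * Polynomial.monom 1 (n - k)" if "k \<le> n"
      using that unfolding UV by (simp add: coeff_linear_poly_power monom_altdef)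
    moreover have "Polynomial.coeff ((U + V) ^ n) k = 0" if "n < k"
    proof (rule coeff_eq_0)
      have "Polynomial.degree ((U + V) ^ n) = n" unfolding UV by (rule degree_linear_power)
      thus "Polynomial.degree ((U + V) ^ n) < k" using that by simp
    qed
    ultimately show ?thesis
      by (cases "k \<le> n") (auto simp: C_def of_nat_poly)
  qed
  have C_U: "C (U ^ n) k j = (if k = 0 \<and> j = n then 1 else 0)" for n k j
    by (auto simp: U_pow C_def coeff_pCons split: nat.splits)
  have C_V: "C (V ^ n) k j = (if k = n \<and> j = 0 then 1 else 0)" for n k j
    by (auto simp: V_pow C_def coeff_1)
  \<comment> \<open>For the constant term c of f this reads c = c + c.\<close>
  have "C (poly F (U + V)) 0 0 = C (poly F U) 0 0 + C (poly F V) 0 0" by (simp add: eq C_add)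
  moreover have "(\<Sum>n\<le>Polynomial.degree f. Polynomial.coeff f n * (if n = 0 then 1 else 0)) = Polynomial.coeff f 0"
    by (simp add: if_distrib sum.delta cong: if_cong)
  moreover have "(2 :: 'a) \<noteq> 1" by (metis add_cancel_right_right one_add_one zero_neq_one)
  ultimately show "Polynomial.coeff f 0 = 0"
    by (simp add: C_F UV_pow C_U C_V if_distrib eq_commute[of 0] cong: if_cong)
  assume k: "k \<ge> 1" "k < n"
  show "of_nat (n choose k) * Polynomial.coeff f n = 0"
  proof (cases "n \<le> Polynomial.degree f")
    case True
    have "C (poly F (U + V)) k (n - k) = C (poly F U) k (n - k) + C (poly F V) k (n - k)" by (simp add: eq C_add)
    also have "\<dots> = 0" using k by (simp add: C_F C_U C_V)
    also have "C (poly F (U + V)) k (n - k)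
        = (\<Sum>i\<le>Polynomial.degree f. if i = n then Polynomial.coeff f i * of_nat (i choose k) else 0)"
      unfolding C_F UV_pow using k by (intro sum.cong) auto
    also have "\<dots> = Polynomial.coeff f n * of_nat (n choose k)" using True by (simp add: sum.delta)
    finally show ?thesis by (simp add: mult.commute)
  qed (simp add: coeff_eq_0)
qed

text \<open>If n = p^j m with m > 1 prime to p, then the binomial coefficient of n over p^j is prime
  to p, as in the counting proof of Sylow's theorem. The mixed coefficients then force the
  coefficient of degree n to vanish.\<close>

lemma additive_poly_iff_p_linear:
  fixes f :: "'a::field poly"
  assumes p: "Factorial_Ring.prime p" "CHAR('a) = p"
  shows "additive_poly f \<longleftrightarrow> p_linear p f"
proof
  assume f: "additive_poly f"
  show "p_linear p f"
    unfolding p_linear_def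
  proof (intro allI impI)
    fix n assume n: "Polynomial.coeff f n \<noteq> 0"
    hence n0: "n > 0" using additive_poly_coeff(1)[OF f] by (cases n) auto
    define j where "j = multiplicity p n"
    obtain m where m: "n = p ^ j * m" "\<not> p dvd m"
      using multiplicity_decompose'[of n p] n0 p(1) unfolding j_def
      by (metis not_prime_unit not_gr_zero)
    have "m = 1"
    proof (rule ccontr)
      assume "m \<noteq> 1"
      hence "p ^ j < n" using m n0 p(1) prime_gt_0_nat by (cases m) auto
      moreover have "1 \<le> p ^ j" using p(1) prime_gt_0_nat by (simp add: Suc_leI)
      ultimately have "of_nat (n choose p ^ j) * Polynomial.coeff f n = 0"
        by (intro additive_poly_coeff(2)[OF f])
      hence "p dvd (n choose p ^ j)" using n p(2) by (simp add: of_nat_eq_0_iff_char_dvd)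
      moreover have "multiplicity p (n choose p ^ j) = 0"
        using const_p_fac[of m p j] m n0 p(1) by (simp add: not_dvd_imp_multiplicity_0)
      moreover have "n choose p ^ j \<noteq> 0" using \<open>p ^ j < n\<close> by simp
      ultimately show False
        using multiplicity_gt_zero_iff[of "n choose p ^ j" p] p(1) not_prime_unit by force
    qed
    thus "\<exists>i. n = p ^ i" using m by auto
  qed
next
  assume "p_linear p f"
  thus "additive_poly f"
    unfolding additive_poly_def Let_def p_linear_def
    by (intro poly_map_poly_additive[OF hom_const_const, of p]) (simp_all add: p)
qed

lemma p_linear_pcompose:
  fixes f g :: "'a::field poly"
  assumes p: "Factorial_Ring.prime p" "CHAR('a) = p" and f: "p_linear p f" and g: "p_linear p g"
  shows "p_linear p (pcompose f g)"
proof -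
  have add: "poly (map_poly (\<lambda>c. [:[:c:]:]) u) (x + y)
      = poly (map_poly (\<lambda>c. [:[:c:]:]) u) x + poly (map_poly (\<lambda>c. [:[:c:]:]) u) y"
    if "p_linear p u" for u :: "'a poly" and x y
    using that unfolding p_linear_def
    by (intro poly_map_poly_additive[OF hom_const_const, of p]) (simp_all add: p)
  have "additive_poly (pcompose f g)"
    unfolding additive_poly_def Let_def map_poly_hom_pcompose[OF hom_const_const] poly_pcompose
    by (simp only: add[OF g] add[OF f])
  thus ?thesis by (simp add: additive_poly_iff_p_linear[OF p])
qed

text \<open>Degrees of nonzero linearized polynomials are powers of p, so the leading term of
  \<open>P\<close> can be cancelled by a p-power monomial composed with \<open>D\<close>. Induction
  on the degree does the rest.\<close>

lemma p_linear_right_division: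
  fixes P D :: "'a::field poly"
  assumes p: "Factorial_Ring.prime p" "CHAR('a) = p" and D: "p_linear p D" "D \<noteq> 0" and P: "p_linear p P"
  shows "\<exists>Q. p_linear p Q \<and>
    (P - pcompose Q D = 0 \<or> Polynomial.degree (P - pcompose Q D) < Polynomial.degree D)"
  using P
proof (induction "Polynomial.degree P" arbitrary: P rule: less_induct)
  case less
  show ?case
  proof (cases "P = 0 \<or> Polynomial.degree P < Polynomial.degree D")
    case True
    thus ?thesis by (intro exI[of _ 0]) (auto simp: p_linear_0)
  next
    case False
    obtain n where n: "Polynomial.degree P = p ^ n"
      using less.prems False unfolding p_linear_def by (metis leading_coeff_0_iff)
    obtain h where h: "Polynomial.degree D = p ^ h"
      using D unfolding p_linear_def by (metis leading_coeff_0_iff)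
    have p1: "p > 1" using p(1) by (rule prime_gt_1_nat)
    have "p ^ h \<le> p ^ n" using False n h by simp
    hence hn: "h \<le> n" using p1 by simp
    define m where "m = p ^ (n - h)"
    define Q where "Q = Polynomial.monom (Polynomial.lead_coeff P / Polynomial.lead_coeff D ^ m) m"
    have lin_Q: "p_linear p Q" unfolding Q_def m_def by (rule p_linear_monom)
    have QD: "pcompose Q D = Polynomial.smult (Polynomial.lead_coeff P / Polynomial.lead_coeff D ^ m) (D ^ m)"
      by (simp add: Q_def monom_altdef pcompose_smult pcompose_power pcompose_pCons)
    have deg: "Polynomial.degree (D ^ m) = p ^ n"
      using hn by (simp add: degree_power_eq D(2) h m_def flip: power_add)
    have "Polynomial.coeff (pcompose Q D) (p ^ n) = Polynomial.lead_coeff P"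
    proof -
      have "Polynomial.coeff (D ^ m) (p ^ n) = Polynomial.lead_coeff D ^ m"
        using lead_coeff_power[of D m] by (simp only: deg)
      thus ?thesis using D(2) by (simp add: QD)
    qed
    hence coeff: "Polynomial.coeff (P - pcompose Q D) (p ^ n) = 0" by (simp add: n)
    have "Polynomial.degree (P - pcompose Q D) \<le> p ^ n"
      using degree_smult_le[of _ "D ^ m"] by (intro degree_diff_le) (simp_all add: n QD deg)
    \<comment> \<open>Otherwise the leading coefficient would vanish, so the difference would be 0
      and have degree 0.\<close>
    moreover have "Polynomial.degree (P - pcompose Q D) \<noteq> p ^ n"
      using coeff p1 by (metis degree_0 leading_coeff_0_iff power_eq_0_iff not_one_less_zero)
    ultimately have "Polynomial.degree (P - pcompose Q D) < Polynomial.degree P" by (simp add: n)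
    moreover have "p_linear p (P - pcompose Q D)"
      using less.prems lin_Q by (intro p_linear_diff p_linear_pcompose[OF p] D)
    ultimately obtain R where R: "p_linear p R" "P - pcompose Q D - pcompose R D = 0 \<or>
        Polynomial.degree (P - pcompose Q D - pcompose R D) < Polynomial.degree D"
      using less.hyps by blast
    have eq: "P - pcompose Q D - pcompose R D = P - pcompose (Q + R) D" by (simp add: pcompose_add)
    show ?thesis using R(2) p_linear_add[OF lin_Q R(1)] unfolding eq by blast
  qed
qed

lemma dvd_pcompose_right: "Polynomial.coeff Q 0 = 0 \<Longrightarrow> D dvd pcompose Q D" for D :: "'a::comm_semiring_1 poly"
  by (cases Q) (simp add: pcompose_pCons)

text \<open>Counted with multiplicity, f has as many linear factors as its degree, and each of them
  divides g.\<close>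

lemma dvd_power_of_roots_subset:
  fixes f g :: "'a::alg_closed_field poly"
  assumes "f \<noteq> 0" and roots: "\<And>x. poly f x = 0 \<Longrightarrow> poly g x = 0"
  shows "f dvd g ^ Polynomial.degree f"
proof -
  obtain A where A: "size A = Polynomial.degree f"
      "f = Polynomial.smult (Polynomial.lead_coeff f) (\<Prod>x\<in>#A. [:-x, 1:])"
    using alg_closed_imp_factorization[OF assms(1)] by blast
  have "[:-x, 1:] dvd g" if "x \<in># A" for x
  proof -
    have "poly f x = 0"
      by (subst A(2)) (use that in \<open>auto simp: poly_prod_mset prod_mset_zero_iff\<close>)
    thus ?thesis using roots by (simp add: poly_eq_0_iff_dvd)
  qed
  hence "(\<Prod>x\<in>#A. [:-x, 1:]) dvd g ^ size A"
  proof (induction A)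
    case (add x A)
    hence "[:-x, 1:] * (\<Prod>x\<in>#A. [:-x, 1:]) dvd g * g ^ size A" by (intro mult_dvd_mono) auto
    thus ?case by (simp only: image_mset_add_mset prod_mset.add_mset size_add_mset power_Suc)
  qed simp
  thus ?thesis by (subst A(2)) (use assms(1) A(1) in \<open>simp add: smult_dvd_iff\<close>)
qed

section \<open>Splitting degrees as orders of Frobenius\<close>

lemma iter_poly_Suc: "iter_poly (Suc n) F = pcompose F (iter_poly n F)"
  by (simp add: iter_poly_def)

lemma p_linear_iter_poly:
  fixes F :: "'a::field poly"
  assumes p: "Factorial_Ring.prime p" "CHAR('a) = p" and F: "p_linear p F"
  shows "p_linear p (iter_poly n F)"
proof (induction n)
  case 0
  have "p_linear p (Polynomial.monom (1 :: 'a) (p ^ 0))" by (rule p_linear_monom)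
  thus ?case by (simp add: iter_poly_def monom_altdef)
next
  case (Suc n)
  thus ?case unfolding iter_poly_Suc by (rule p_linear_pcompose[OF p F])
qed

lemma degree_iter_poly: "Polynomial.degree (iter_poly n F) = Polynomial.degree F ^ n"
  for F :: "'a::{comm_semiring_1,semiring_no_zero_divisors} poly"
proof (induction n)
  case 0
  show ?case by (simp add: iter_poly_def)
qed (simp add: iter_poly_Suc degree_pcompose)

lemmas to_ac_hom = to_ac_0 to_ac_1 to_ac_add to_ac_mult

abbreviation ac_poly :: "'a::field poly \<Rightarrow> 'a alg_closure poly" where
  "ac_poly f \<equiv> map_poly to_ac f"

lemma ac_poly_iter: "poly (ac_poly (iter_poly n F)) x = (poly (ac_poly F) ^^ n) x"
proof (induction n)
  case 0
  show ?case by (simp add: iter_poly_def map_poly_pCons)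
qed (simp add: iter_poly_Suc map_poly_hom_pcompose[OF to_ac_hom] poly_pcompose)

lemma degree_ac_poly: "Polynomial.degree (ac_poly f) = Polynomial.degree f"
  by (rule degree_map_poly) simp

lemma ac_poly_eq_0_iff: "ac_poly f = 0 \<longleftrightarrow> f = 0"
  by (simp add: map_poly_eq_0_iff)

lemma surj_ac_poly:
  assumes "Polynomial.degree f > 0"
  shows "surj (poly (ac_poly f))"
  unfolding surj_def
proof
  fix y
  have "Polynomial.degree (ac_poly f + - [:y:]) = Polynomial.degree f"
    using assms degree_ac_poly[of f] by (subst degree_add_eq_left) simp_all
  hence "Polynomial.degree (ac_poly f - [:y:]) > 0"
    using assms by (simp only: diff_conv_add_uminus)
  then obtain x where "poly (ac_poly f - [:y:]) x = 0" using alg_closed_imp_poly_has_root by blast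
  thus "\<exists>x. y = poly (ac_poly f) x" by (intro exI[of _ x]) simp
qed

text \<open>Split off the largest power of the variable, A = X^k G with G(0) nonzero. A constant G
  would make A an excluded monomial, so G has a root, necessarily nonzero.\<close>

lemma ac_poly_kernel:
  fixes A :: "'a::field poly"
  assumes A: "p_linear p A" and nonmonom: "\<not> (\<exists>a h. A = Polynomial.monom a (p ^ h))"
  shows "\<exists>x. x \<noteq> 0 \<and> poly (ac_poly A) x = 0"
proof -
  have A0: "A \<noteq> 0" using nonmonom by (metis monom_eq_0)
  define k where "k = (LEAST i. Polynomial.coeff A i \<noteq> 0)"
  have k: "Polynomial.coeff A k \<noteq> 0" unfolding k_def
    by (rule LeastI_ex) (use A0 leading_coeff_0_iff in blast)
  have "Polynomial.coeff A i = 0" if "i < k" for i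
    using not_less_Least[of i "\<lambda>i. Polynomial.coeff A i \<noteq> 0"] that unfolding k_def by blast
  hence "Polynomial.monom 1 k dvd A" using A0 by (simp add: monom_1_dvd_iff')
  then obtain G where G: "A = Polynomial.monom 1 k * G" by blast
  have G0: "Polynomial.coeff G 0 \<noteq> 0" using k by (simp add: G coeff_monom_mult)
  have "Polynomial.degree G > 0"
  proof (rule ccontr)
    assume "\<not> Polynomial.degree G > 0"
    then obtain c where "G = [:c:]" using degree_eq_zeroE by blast
    hence "A = Polynomial.monom c k" by (simp add: G smult_monom)
    moreover obtain h where "k = p ^ h" using A k unfolding p_linear_def by blast
    ultimately show False using nonmonom by blast
  qed
  then obtain x where x: "poly (ac_poly G) x = 0"
    using alg_closed_imp_poly_has_root degree_ac_poly by metis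
  have "poly (ac_poly G) 0 = to_ac (Polynomial.coeff G 0)" by (simp add: poly_0_coeff_0 coeff_map_poly)
  hence "x \<noteq> 0" using x G0 by auto
  moreover have "poly (ac_poly A) x = 0" by (simp add: G map_poly_hom_mult[OF to_ac_hom] x)
  ultimately show ?thesis by blast
qed

lemma funpow_frobenius: "((\<lambda>x. x ^ q) ^^ s) x = x ^ (q ^ s)" for x :: "'a::monoid_mult"
  by (induction s) (simp_all add: mult.commute flip: power_mult)

section \<open>Frobenius and the evaluation of A as commuting additive maps\<close>

locale nonmonomial_additive =
  fixes A :: "'a::finite_field poly" and p q e :: nat
  assumes p: "Factorial_Ring.prime p" and e: "e \<ge> 1" and q: "q = p ^ e" and card: "CARD('a) = q"
    and additive: "additive_poly A" and nonmonom: "\<not> (\<exists>a h. A = Polynomial.monom a (p ^ h))"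
begin

lemma char: "CHAR('a) = p"
proof -
  have "of_nat p ^ e = (0 :: 'a)" using of_nat_card_eq_0[where 'a = 'a] unfolding card q by simp
  hence "CHAR('a) dvd p" by (simp add: of_nat_eq_0_iff_char_dvd[symmetric])
  moreover have "CHAR('a) \<noteq> 1" by simp
  ultimately show ?thesis using p by (auto simp: prime_nat_iff)
qed

lemma card_power: "q ^ s = p ^ (e * s)"
  by (simp add: q power_mult)

lemma q_ge_2: "q \<ge> 2"
  using p e prime_ge_2_nat[of p] self_le_power[of p e] unfolding q by linarith

definition frob :: "'a alg_closure \<Rightarrow> 'a alg_closure" where "frob x = x ^ q"

lemma frob_funpow: "(frob ^^ s) x = x ^ (q ^ s)"
  using funpow_frobenius[where q = q and s = s and x = x] by (simp add: frob_def[abs_def])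

lemma frob_power_add: "(x + y) ^ (q ^ s) = x ^ (q ^ s) + y ^ (q ^ s)" for x y :: "'a alg_closure"
  by (rule freshmans_dream'[where n = "e * s"]) (simp_all add: char p card_power)

lemma additive_frob: "Modules.additive frob"
  using frob_power_add[of _ _ 1] by (simp add: Modules.additive_def frob_def)

lemma frob_to_ac: "frob (to_ac c) = to_ac c"
  using finite_field_power_card_eq_same[of c] by (simp add: frob_def card flip: to_ac_power)

text \<open>Frobenius is a ring homomorphism fixing the coefficients, which come from the ground
  field.\<close>

lemma frob_ac_poly: "frob (poly (ac_poly F) x) = poly (ac_poly F) (frob x)"
proof (induction F)
  case 0
  show ?case using q_ge_2 by (simp add: frob_def)
next
  case (pCons c F)
  have "frob (x * poly (ac_poly F) x) = frob x * poly (ac_poly F) (frob x)"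
    using pCons.IH by (simp add: frob_def power_mult_distrib)
  thus ?case
    by (simp add: map_poly_pCons Modules.additive.add[OF additive_frob] frob_to_ac)
qed

lemma inj_frob: "inj frob"
proof (rule injI)
  fix x y assume "frob x = frob y"
  hence "frob (x - y) = 0" by (simp add: Modules.additive.diff[OF additive_frob])
  thus "x = y" by (simp add: frob_def)
qed

lemma p_linear: "p_linear p A"
  using additive by (simp add: additive_poly_iff_p_linear[OF p char])

lemma degree_pos: "Polynomial.degree A > 0"
proof (rule ccontr)
  assume "\<not> Polynomial.degree A > 0"
  then obtain c where c: "A = [:c:]" using degree_eq_zeroE by blast
  hence "c = 0" using p_linear_coeff_0[OF p_linear] p prime_gt_0_nat by simp
  hence "A = Polynomial.monom 0 (p ^ 0)" using c by simp
  thus False using nonmonom by blast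
qed

lemma finite_roots: "f \<noteq> 0 \<Longrightarrow> finite {x. poly (ac_poly f) x = 0}"
  by (rule poly_roots_finite) (simp add: ac_poly_eq_0_iff)

sublocale commuting_additive_maps p q frob "poly (ac_poly A)"
proof
  show "Factorial_Ring.prime p" by (rule p)
  show "of_nat p = (0 :: 'a alg_closure)" using of_nat_CHAR[where 'a = "'a alg_closure"] by (simp add: char)
  show "frob (x + y) = frob x + frob y" for x y by (rule Modules.additive.add[OF additive_frob])
  show "poly (ac_poly A) (x + y) = poly (ac_poly A) x + poly (ac_poly A) y" for x y
    using p_linear unfolding p_linear_def
    by (intro poly_map_poly_additive[OF to_ac_hom, of p]) (simp_all add: p char)
  show "frob (poly (ac_poly A) x) = poly (ac_poly A) (frob x)" for x by (rule frob_ac_poly)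
  show "inj frob" by (rule inj_frob)
  show "surj (poly (ac_poly A))" by (rule surj_ac_poly[OF degree_pos])
  show "finite {x. poly (ac_poly A) x = 0}" using degree_pos by (intro finite_roots) auto
  show "\<exists>x. x \<noteq> 0 \<and> poly (ac_poly A) x = 0" by (rule ac_poly_kernel[OF p_linear nonmonom])
  show "finite {x. (frob ^^ s) x = x} \<and> card {x. (frob ^^ s) x = x} \<le> q ^ s" if "s > 0" for s
  proof -
    have "card {x. (frob ^^ s) x = x} = q ^ s"
      unfolding frob_funpow by (rule card_frobenius_fixed[OF that, where 'a = 'a, unfolded card])
    moreover from this have "finite {x. (frob ^^ s) x = x}"
      using q_ge_2 by (intro card_ge_0_finite) simp
    ultimately show ?thesis by simp
  qed
qed

lemma ext_field_frob: "s > 0 \<Longrightarrow> ext_field s = {x. (frob ^^ s) x = x}"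
  unfolding frob_funpow by (rule ext_field_eq[OF p card[unfolded q], unfolded card])

lemma splits_over_iff:
  assumes s: "s > 0" and F: "F \<noteq> 0"
  shows "splits_over (ext_field s) (ac_poly F) \<longleftrightarrow> (\<forall>x. poly (ac_poly F) x = 0 \<longrightarrow> (frob ^^ s) x = x)"
proof
  assume "splits_over (ext_field s) (ac_poly F)"
  then obtain c M where M: "set_mset M \<subseteq> ext_field s"
    and F_eq: "ac_poly F = Polynomial.smult c (\<Prod>x\<in>#M. [:-x, 1:])"
    unfolding splits_over_def by blast
  have "c \<noteq> 0" using F F_eq by (metis ac_poly_eq_0_iff smult_0_left)
  hence "x \<in># M" if "poly (ac_poly F) x = 0" for x
    using that unfolding F_eq by (auto simp: poly_prod_mset prod_mset_zero_iff)
  thus "\<forall>x. poly (ac_poly F) x = 0 \<longrightarrow> (frob ^^ s) x = x" using M ext_field_frob[OF s] by blast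
next
  assume roots: "\<forall>x. poly (ac_poly F) x = 0 \<longrightarrow> (frob ^^ s) x = x"
  let ?c = "Polynomial.lead_coeff (ac_poly F)"
  obtain M where M: "ac_poly F = Polynomial.smult ?c (\<Prod>x\<in>#M. [:-x, 1:])"
    using alg_closed_imp_factorization F ac_poly_eq_0_iff by blast
  have "poly (ac_poly F) x = 0" if "x \<in># M" for x
    by (subst M) (use that in \<open>auto simp: poly_prod_mset prod_mset_zero_iff\<close>)
  hence "set_mset M \<subseteq> ext_field s" using roots ext_field_frob[OF s] by blast
  \<comment> \<open>The leading coefficient comes from the ground field, hence is fixed by
    Frobenius.\<close>
  moreover have "?c \<in> ext_field s"
  proof -
    have "?c = to_ac (Polynomial.lead_coeff F)" by (simp add: coeff_map_poly degree_ac_poly)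
    moreover have "(frob ^^ s) (to_ac c) = to_ac c" for c by (induction s) (simp_all add: frob_to_ac)
    ultimately show ?thesis using ext_field_frob[OF s] by simp
  qed
  ultimately show "splits_over (ext_field s) (ac_poly F)" using M unfolding splits_over_def by blast
qed

lemma split_deg_eq_period:
  assumes "Polynomial.degree F > 0"
  shows "split_deg F n = period frob {x. (poly (ac_poly F) ^^ n) x = 0}"
proof -
  have "iter_poly n F \<noteq> 0" using degree_iter_poly[of n F] assms by (cases "n = 0") (auto simp: iter_poly_def)
  thus ?thesis
    unfolding split_deg_def period_def
    by (intro arg_cong[of _ _ Least] ext) (auto simp: splits_over_iff ac_poly_iter)
qed

lemma split_deg_A: "split_deg A n = ord n"
  unfolding ord_def V_def by (rule split_deg_eq_period[OF degree_pos])

lemma split_deg_iter: "k \<ge> 1 \<Longrightarrow> split_deg (iter_poly k A) n = ord (k * n)"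
proof -
  have "Polynomial.degree (iter_poly k A) > 0" using degree_pos by (simp add: degree_iter_poly)
  moreover have "poly (ac_poly (iter_poly k A)) = poly (ac_poly A) ^^ k" using ac_poly_iter by blast
  ultimately show ?thesis by (simp add: split_deg_eq_period ord_def V_def funpow_mult)
qed

lemma split_deg_affine: "split_deg (A + [:b:]) n \<in> {ord n, p * ord n}"
proof -
  have "Polynomial.degree (A + [:b:]) > 0" using degree_pos degree_add_eq_left[of "[:b:]" A] by simp
  moreover have "poly (ac_poly (A + [:b:])) = (\<lambda>x. poly (ac_poly A) x + to_ac b)"
    by (simp add: map_poly_hom_add[OF to_ac_hom] map_poly_pCons fun_eq_iff)
  ultimately show ?thesis using period_affine[OF frob_to_ac[of b], of n] by (simp add: split_deg_eq_period)
qed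

text \<open>The identity defining A_*, with \<open>B\<close> for A_* and m for s_0;
  \<open>monom 1 1\<close> is the variable.\<close>

abbreviation left_factor :: "'a poly \<Rightarrow> nat \<Rightarrow> nat \<Rightarrow> nat \<Rightarrow> bool" where
  "left_factor B r s m \<equiv> Polynomial.monom 1 1 ^ (q ^ (s + r)) - Polynomial.monom 1 1 ^ (q ^ r) = pcompose B (iter_poly m A)"

lemma poly_power_diff: "(Polynomial.monom 1 1 ^ (q ^ s) - Polynomial.monom 1 1) ^ (q ^ r)
    = (Polynomial.monom 1 1 ^ (q ^ (s + r)) - Polynomial.monom 1 1 ^ (q ^ r) :: 'a poly)"
  using freshmans_dream_diff[where 'a = "'a poly" and m = "q ^ r" and n = "e * r"]
  by (simp add: char p card_power power_add flip: power_mult)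

text \<open>With t the degree of \<open>D\<close>, the exponent q^t is at least t and absorbs all
  multiplicities of roots of \<open>D\<close>. One more q-th power turns the quotient Q into the
  required Q^q and makes r = t + 1 positive.\<close>

lemma left_factor_exists:
  fixes m s :: nat
  assumes s: "s = ord m"
  shows "\<exists>R r. additive_poly R \<and> r \<ge> 1 \<and> left_factor (R ^ q) r s m"
proof -
  define g :: "'a poly" where "g = Polynomial.monom 1 1 ^ (q ^ s) - Polynomial.monom 1 1"
  define D where "D = iter_poly m A"
  define t where "t = Polynomial.degree D"
  have D: "p_linear p D" "D \<noteq> 0"
    using p_linear_iter_poly[OF p char p_linear] degree_iter_poly[of m A] degree_pos
    by (auto simp: D_def)
  \<comment> \<open>In characteristic p this power is a difference of two monomials with p-power
    exponents.\<close>
  have lin: "p_linear p (g ^ (q ^ t))"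
    unfolding g_def poly_power_diff
    unfolding card_power
    by (intro p_linear_diff) (simp_all add: monom_power p_linear_monom)
  obtain Q where Q: "p_linear p Q" "g ^ (q ^ t) - pcompose Q D = 0 \<or>
      Polynomial.degree (g ^ (q ^ t) - pcompose Q D) < Polynomial.degree D"
    using p_linear_right_division[OF p char D lin] by blast
  \<comment> \<open>The remainder is divisible by \<open>D\<close>, hence zero, because the roots of \<open>D\<close> are roots of \<open>g\<close>.\<close>
  have "ac_poly D dvd ac_poly g ^ Polynomial.degree (ac_poly D)"
  proof (rule dvd_power_of_roots_subset)
    show "ac_poly D \<noteq> 0" using D by (simp add: ac_poly_eq_0_iff)
    fix x assume "poly (ac_poly D) x = 0"
    hence "x \<in> V m" by (simp add: D_def ac_poly_iter V_def)
    hence "(frob ^^ s) x = x" unfolding s by (rule ord_fixed)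
    thus "poly (ac_poly g) x = 0"
      by (simp add: g_def map_poly_hom_diff[OF to_ac_hom] map_poly_hom_power[OF to_ac_hom]
          map_poly_monom poly_monom frob_funpow)
  qed
  also have "\<dots> dvd ac_poly g ^ (q ^ t)"
    using power_gt_expt[of q t] q_ge_2 by (intro le_imp_power_dvd) (simp add: degree_ac_poly t_def)
  finally have "ac_poly D dvd ac_poly (g ^ (q ^ t))" by (simp add: map_poly_hom_power[OF to_ac_hom])
  moreover have "D dvd pcompose Q D"
    using p_linear_coeff_0[OF Q(1)] p prime_gt_0_nat by (intro dvd_pcompose_right) simp
  hence "ac_poly D dvd ac_poly (pcompose Q D)"
    by (elim dvdE) (simp add: map_poly_hom_mult[OF to_ac_hom])
  ultimately have "ac_poly D dvd ac_poly (g ^ (q ^ t) - pcompose Q D)"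
    unfolding map_poly_hom_diff[OF to_ac_hom] by (rule dvd_diff)
  hence "g ^ (q ^ t) - pcompose Q D = 0"
    using Q(2) dvd_imp_degree_le degree_ac_poly ac_poly_eq_0_iff by (metis not_le)
  hence "pcompose (Q ^ q) D = (g ^ (q ^ t)) ^ q" by (simp add: pcompose_power)
  also have "\<dots> = g ^ (q ^ (t + 1))" by (simp add: mult.commute flip: power_mult)
  finally have "left_factor (Q ^ q) (t + 1) s m" unfolding g_def poly_power_diff D_def by simp
  thus ?thesis using Q(1) additive_poly_iff_p_linear[OF p char] by (intro exI[of _ Q] exI[of _ "t + 1"]) simp
qed

text \<open>Evaluation turns the polynomial identity into the hypotheses on \<open>B\<close> of the
  nilpotency criterion.\<close>

lemma left_factor_eval:
  assumes R: "additive_poly R" "B = R ^ q" and rel: "left_factor B r s m"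
  shows "poly (ac_poly B) 0 = 0"
    and "poly (ac_poly B) ((poly (ac_poly A) ^^ m) x) = (frob ^^ r) ((frob ^^ s) x - x)"
proof -
  have "Polynomial.coeff R 0 = 0"
    using R(1) p_linear_coeff_0[of p R] p prime_gt_0_nat by (simp add: additive_poly_iff_p_linear[OF p char])
  hence "poly (ac_poly R) 0 = 0" by (simp add: poly_0_coeff_0 coeff_map_poly)
  thus "poly (ac_poly B) 0 = 0"
    using q_ge_2 by (simp add: R(2) map_poly_hom_power[OF to_ac_hom])
  have "poly (ac_poly B) ((poly (ac_poly A) ^^ m) x) = poly (ac_poly (pcompose B (iter_poly m A))) x"
    by (simp add: map_poly_hom_pcompose[OF to_ac_hom] poly_pcompose ac_poly_iter)
  also have "\<dots> = x ^ (q ^ (s + r)) - x ^ (q ^ r)"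
    by (simp add: map_poly_hom_diff[OF to_ac_hom] map_poly_hom_power[OF to_ac_hom]
        map_poly_monom poly_monom flip: rel)
  also have "\<dots> = (frob ^^ r) ((frob ^^ s) x - x)"
    unfolding Modules.additive.diff[OF add_\<sigma>n]
    by (simp add: frob_funpow power_add flip: power_mult)
  finally show "poly (ac_poly B) ((poly (ac_poly A) ^^ m) x) = (frob ^^ r) ((frob ^^ s) x - x)" .
qed

end

section \<open>Translation of the results on orders into splitting degrees\<close>

theorem theorem1p2:
  fixes A :: "'a::finite_field poly" and p q e :: nat
  assumes "Factorial_Ring.prime p" and "e \<ge> 1" and "q = p ^ e" and "CARD('a) = q"
    and "additive_poly A"
    and "\<not> (\<exists>a h. A = Polynomial.monom a (p ^ h))"
  shows
    "\<comment> \<open>(i)\<close>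
     (\<forall>n\<ge>1. split_deg A (n * p) \<in> {split_deg A n, p * split_deg A n}) \<and>
     (\<forall>n\<ge>1. \<exists>i::nat. real i < log (real p) (real n) + 1 \<and>
        split_deg A n = split_deg A 1 * p ^ i) \<and>
     \<comment> \<open>(ii)\<close>
     (\<forall>b. b \<noteq> 0 \<longrightarrow> (\<forall>n\<ge>1.
        split_deg (A + [:b:]) n \<in> {split_deg A n, p * split_deg A n})) \<and>
     \<comment> \<open>(iii)\<close>
     bounded (split_ratio A ` {1..}) \<and>
     split_const A > 0 \<and>
     limit_points (split_ratio A) = {split_const A..real p * split_const A} \<and>
     \<comment> \<open>(iv)\<close>
     (\<forall>b. b \<noteq> 0 \<longrightarrow>
        bounded (split_ratio (A + [:b:]) ` {1..}) \<and>
        limit_points (split_ratio (A + [:b:])) \<subseteq> {split_const A..(real p)\<^sup>2 * split_const A}) \<and>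
     \<comment> \<open>(v)\<close>
     (\<forall>k\<ge>1. split_const (iter_poly k A) = real k * split_const A) \<and>
     \<comment> \<open>the moreover part\<close>
     (let J = {j. j > 0 \<and> split_deg A j = split_deg A 1};
          s0 = Max J;
          s1 = split_deg A 1;
          x = Polynomial.monom 1 1 :: 'a poly;
          rel = (\<lambda>B r. (\<exists>R. additive_poly R \<and> B = R ^ q) \<and> r \<ge> 1 \<and>
                   (x ^ (q ^ s1) - x) ^ (q ^ r) = x ^ (q ^ (s1 + r)) - x ^ (q ^ r) \<and>
                   x ^ (q ^ (s1 + r)) - x ^ (q ^ r) = pcompose B (iter_poly s0 A))
      in finite J \<and>
         (\<exists>B r. rel B r) \<and>
         split_const A \<le> real s1 / real s0 \<and>
         (\<forall>B r. rel B r \<longrightarrow>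
            (split_const A = real s1 / real s0 \<longleftrightarrow>
             \<not> nilpotent_on (ext_field s1) (poly (map_poly to_ac B)))) \<and>
         (split_const A = real s1 / real s0 \<longrightarrow>
            (\<forall>n>s0. split_deg A n = s1 * p ^ nat \<lceil>log (real p) (real n / real s0)\<rceil>)))"
proof -
  interpret nonmonomial_additive A p q e
    using assms by unfold_locales
  interpret S: growth_sequence ord p q
    using growth_sequence_ord[of 1] by simp
  have ratio: "split_ratio A = (\<lambda>n. real (ord n) / real n)"
    by (simp add: split_ratio_def[abs_def] split_deg_A)
  have const: "split_const A = S.ratio_const"
    using S.ratio_const_pos S.limit_points_ratio by (intro split_const_eq) (simp_all add: ratio char)
  define s0 where "s0 = S.last_index 0"
  define J where "J = {j. j > 0 \<and> split_deg A j = split_deg A 1}"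
  \<comment> \<open>The set defining s_0 is level 0, so its maximum is
    \<open>last_index 0\<close>.\<close>
  have J: "J = {n. 1 \<le> n \<and> ord n \<le> ord 1 * p ^ 0}"
    using S.first_level by (simp add: J_def split_deg_A)
  have "finite J" unfolding J by (rule S.finite_level)
  have Max_J: "Max J = s0" unfolding J s0_def S.last_index_def ..
  have ord_s0: "ord s0 = ord 1"
    unfolding s0_def using S.s_le_last_index_0[OF S.last_index_in(1)] by simp

  have i: "\<forall>n\<ge>1. split_deg A (n * p) \<in> {split_deg A n, p * split_deg A n}"
    using ord_mult by (simp add: split_deg_A)
  have i': "\<forall>n\<ge>1. \<exists>i::nat. real i < log (real p) (real n) + 1 \<and> split_deg A n = split_deg A 1 * p ^ i"
    unfolding split_deg_A using ord_power_log by blast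
  have ii: "\<forall>b. b \<noteq> 0 \<longrightarrow> (\<forall>n\<ge>1. split_deg (A + [:b:]) n \<in> {split_deg A n, p * split_deg A n})"
    using split_deg_affine by (simp add: split_deg_A)
  have iii: "bounded (split_ratio A ` {1..})" "split_const A > 0"
      "limit_points (split_ratio A) = {split_const A..real p * split_const A}"
    unfolding ratio const by (rule S.ratio_bounded S.ratio_const_pos S.limit_points_ratio)+
  have iv: "\<forall>b. b \<noteq> 0 \<longrightarrow> bounded (split_ratio (A + [:b:]) ` {1..}) \<and>
      limit_points (split_ratio (A + [:b:])) \<subseteq> {split_const A..(real p)\<^sup>2 * split_const A}"
  proof (intro allI impI)
    fix b :: 'a
    note bounds = S.ratio_multiples[of "\<lambda>n. split_deg (A + [:b:]) n", OF split_deg_affine]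
    show "bounded (split_ratio (A + [:b:]) ` {1..}) \<and>
        limit_points (split_ratio (A + [:b:])) \<subseteq> {split_const A..(real p)\<^sup>2 * split_const A}"
      unfolding const split_ratio_def[abs_def] by (rule conjI[OF bounds])
  qed
  have v: "split_const (iter_poly k A) = real k * split_const A" if k: "k \<ge> 1" for k
  proof -
    interpret T: growth_sequence "\<lambda>n. ord (k * n)" p q by (rule growth_sequence_ord[OF k])
    have "split_const (iter_poly k A) = T.ratio_const"
      using T.ratio_const_pos T.limit_points_ratio
      by (intro split_const_eq) (simp_all add: split_ratio_def[abs_def] split_deg_iter[OF k] char)
    thus ?thesis
      unfolding const
      using ratio_const_multiple[OF S.growth_sequence_axioms k T.growth_sequence_axioms] by simp
  qed

  define rel where "rel B r \<longleftrightarrow> (\<exists>R. additive_poly R \<and> B = R ^ q) \<and> r \<ge> 1 \<and>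
      (Polynomial.monom 1 1 ^ (q ^ ord 1) - Polynomial.monom 1 1) ^ (q ^ r)
        = Polynomial.monom 1 1 ^ (q ^ (ord 1 + r)) - (Polynomial.monom 1 1 ^ (q ^ r) :: 'a poly) \<and>
      left_factor B r (ord 1) s0" for B r
  have rel_ex: "\<exists>B r. rel B r"
    using left_factor_exists[OF ord_s0[symmetric]] poly_power_diff unfolding rel_def by blast
  have rel_iff: "split_const A = real (ord 1) / real s0 \<longleftrightarrow>
      \<not> nilpotent_on (ext_field (ord 1)) (poly (map_poly to_ac B))" if rel: "rel B r" for B r
  proof -
    obtain R where "additive_poly R" "B = R ^ q" "left_factor B r (ord 1) s0"
      using rel unfolding rel_def by blast
    note B = left_factor_eval[OF this]
    show ?thesis
      unfolding const ext_field_frob[OF ord_pos]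
      by (rule extremal_iff_not_nilpotent[OF B s0_def refl])
  qed
  have le: "split_const A \<le> real (ord 1) / real s0"
    unfolding const s0_def by (rule S.ratio_const_le_first)
  have extremal: "split_deg A n = ord 1 * p ^ nat \<lceil>log (real p) (real n / real s0)\<rceil>"
    if "split_const A = real (ord 1) / real s0" "n > s0" for n
    using that S.ratio_const_eq_iff S.s_extremal unfolding const s0_def split_deg_A by blast
  show ?thesis
    unfolding Let_def J_def[symmetric] Max_J
    unfolding split_deg_A[of 1]
    unfolding rel_def[symmetric]
    by (intro conjI i[unfolded split_deg_A[of 1]] i'[unfolded split_deg_A[of 1]] ii iii iv \<open>finite J\<close>
        rel_ex le allI impI v rel_iff extremal)
qed

end
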